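(* Let $n\ge2$, $1\le k\le n-1$, $\alpha_1,\alpha_2\in\mathbb{R}$ with $\alpha_2>0$, and $p=1+\alpha_2$. For $\gamma_1,\gamma_2\in\mathbb{R}$ consider $$\|\sin^{\gamma_1}d(0,\cdot)\cos^{\gamma_2}d(0,\cdot)\,R_kf\|_{L^\infty(\Xi_k(\mathbb{S}^n))}\le C\|f\|_{L^{p,1}_{\alpha_1,\alpha_2}(\mathbb{S}^n)}\quad\text{for all even radial }f\in L^{p,1}_{\alpha_1,\alpha_2}(\mathbb{S}^n).\qquad( * )$$ (A) If $k\ge2$, $( * )$ holds if and only if $\gamma_1\ge\max\{0,\frac{\alpha_1+n}{p}-k\}$ and $\gamma_2\ge1$. (B) If $k=1$, $( * )$ holds if and only if these conditions hold and $p\ge2$.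
   Context: $\mathbb{S}^n\subset\mathbb{R}^{n+1}$ unit sphere with origin $0:=e_{n+1}$, distance $d$, surface measure $dx$. $\Xi_k(\mathbb{S}^n)$: $k$-dimensional totally geodesic submanifolds (intersections with $(k+1)$-dimensional linear subspaces) with $d(0,\xi)<\pi/2$, with rotation-invariant measure ($L^\infty$ = essential supremum). $R_kf(\xi)=\int_\xi f\,d_\xi x$. $L^{p,1}_{\alpha_1,\alpha_2}(\mathbb{S}^n)$ is the Lorentz space $L^{p,1}(\mathbb{S}^n,\mu)$ for $d\mu=\sin^{\alpha_1}d(0,x)|\cos d(0,x)|^{\alpha_2}dx$, with norm $p\int_0^\infty\mu(\{|f|>s\})^{1/p}ds$. Even radial: $f(x)=F(|x_{n+1}|)$. $C$ independent of $f$. *)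

theory Defs
  imports "HOL-Analysis.Analysis"
begin

text \<open>Surface measure on the unit sphere of a Euclidean space of dimension d,
  defined via the cone construction: sigma(A) = d * Leb({t x : x in A, 0 < t < 1}),
  i.e. the push-forward of d times Lebesgue measure on the punctured unit ball
  under x maps to x / |x|.\<close>
definition sphere_measure :: "'a::euclidean_space measure" where
  "sphere_measure = scale_measure (of_nat DIM('a))
     (distr (restrict_space lborel (ball 0 1 - {0})) borel (\<lambda>x. x /\<^sub>R norm x))"

definition sph_dist :: "'a::real_inner \<Rightarrow> 'a \<Rightarrow> real" where
  "sph_dist x y = arccos (x \<bullet> y)"

definition great_sphere :: "'a::real_normed_vector set \<Rightarrow> 'a set" where
  "great_sphere V = V \<inter> sphere 0 1"

definition dist_origin :: "'a::real_inner \<Rightarrow> 'a set \<Rightarrow> real" where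
  "dist_origin e V = Inf ((\<lambda>x. sph_dist e x) ` great_sphere V)"

text \<open>Xi_k: k-dimensional totally geodesic submanifolds (given by (k+1)-dimensional
  linear subspaces V) with d(o, xi) < pi/2.\<close>
definition Xi :: "'a::euclidean_space \<Rightarrow> nat \<Rightarrow> 'a set \<Rightarrow> bool" where
  "Xi e k V \<longleftrightarrow> subspace V \<and> dim V = k + 1 \<and> dist_origin e V < pi / 2"

definition onframe :: "real^'m^'k \<Rightarrow> (real^'m) set \<Rightarrow> bool" where
  "onframe u V \<longleftrightarrow> (\<forall>i j. u $ i \<bullet> u $ j = (if i = j then 1 else 0))
      \<and> span (range (\<lambda>j. u $ j)) = V"

text \<open>The totally geodesic Radon transform R_k f(xi) = integral of f over xi = great_sphere V
  w.r.t. its surface measure, with CARD('k) = k + 1: the surface measure of xi is the image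
  of the surface measure of S^k under the isometry c maps to sum_j c_j u_j, u an orthonormal
  frame of V.\<close>
definition radon_param :: "'k::finite itself \<Rightarrow> (real^'m) set \<Rightarrow> real^'k \<Rightarrow> real^'m" where
  "radon_param K V = (let u = (SOME u :: real^'m^'k. onframe u V) in
      (\<lambda>c. \<Sum>j\<in>UNIV. c $ j *\<^sub>R u $ j))"

definition radon :: "'k::finite itself \<Rightarrow> (real^'m \<Rightarrow> real) \<Rightarrow> (real^'m) set \<Rightarrow> real" where
  "radon K f V = (\<integral>c. f (radon_param K V c) \<partial>(sphere_measure :: (real^'k) measure))"

definition radon_integrable :: "'k::finite itself \<Rightarrow> (real^'m \<Rightarrow> real) \<Rightarrow> (real^'m) set \<Rightarrow> bool" where
  "radon_integrable K f V \<longleftrightarrow>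
     integrable (sphere_measure :: (real^'k) measure) (\<lambda>c. f (radon_param K V c))"

definition weighted_sphere :: "'a::euclidean_space \<Rightarrow> real \<Rightarrow> real \<Rightarrow> 'a measure" where
  "weighted_sphere e a1 a2 = density sphere_measure
     (\<lambda>x. ennreal (sin (sph_dist e x) powr a1 * \<bar>cos (sph_dist e x)\<bar> powr a2))"

definition epowr :: "ennreal \<Rightarrow> real \<Rightarrow> ennreal" where
  "epowr x a = (if x = \<infinity> then \<infinity> else ennreal (enn2real x powr a))"

definition lorentz_norm :: "real \<Rightarrow> 'a measure \<Rightarrow> ('a \<Rightarrow> real) \<Rightarrow> ennreal" where
  "lorentz_norm p M f = ennreal p *
     (\<integral>\<^sup>+ s. indicator {0<..} s * epowr (emeasure M {x \<in> space M. \<bar>f x\<bar> > s}) (1 / p) \<partial>lborel)"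

text \<open>The estimate (*): for some constant C, for every even radial f = F(|x_{n+1}|) in
  L^{p,1}_{a1,a2}, p = 1 + a2, the function sin^g1 d(o,.) cos^g2 d(o,.) R_k f is defined and
  bounded by C ||f|| for almost every xi in Xi_k. "Almost every" w.r.t. the rotation-invariant
  measure on Xi_k is expressed via (k+1)-tuples of vectors (rows of w) distributed by Lebesgue
  measure, whose span is uniformly distributed on the Grassmannian (same null sets).\<close>
definition radon_Linf_estimate ::
  "'k::finite itself \<Rightarrow> real^'m \<Rightarrow> real \<Rightarrow> real \<Rightarrow> real \<Rightarrow> real \<Rightarrow> bool" where
  "radon_Linf_estimate K e a1 a2 g1 g2 \<longleftrightarrow>
    (\<exists>C::real. \<forall>F::real \<Rightarrow> real. F \<in> borel_measurable borel \<longrightarrow>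
       (let f = (\<lambda>x::real^'m. F \<bar>x \<bullet> e\<bar>) in
        lorentz_norm (1 + a2) (weighted_sphere e a1 a2) f < \<infinity> \<longrightarrow>
        (AE w in (lborel :: (real^'m^'k) measure).
           Xi e (CARD('k) - 1) (span (range (\<lambda>j. w $ j))) \<longrightarrow>
           (let V = span (range (\<lambda>j. w $ j)) in
             radon_integrable K f V \<and>
             \<bar>sin (dist_origin e V) powr g1 * cos (dist_origin e V) powr g2 * radon K f V\<bar>
               \<le> C * enn2real (lorentz_norm (1 + a2) (weighted_sphere e a1 a2) f)))))"

end

theory Submission
  imports Defs
begin

text \<open>Both sides only see the height t = |x_{n+1}|. Under the surface measure of the k-sphere the
  height has density proportional to (1 - t^2)^(k/2 - 1), and a great sphere at distance d from the
  origin is a k-sphere whose heights are scaled by c = cos d. By the layer cake formula the estimate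
  is equivalent to its restriction to indicators of Borel sets E of heights,
  (1 - c^2)^(g1/2) c^g2 m{t. c t in E} <= C nu(E)^(1/p), where m has density (1 - t^2)^(k/2 - 1) and
  nu has density (1 - t^2)^((a1 + n)/2 - 1) t^(p - 1). It is only given for almost every great
  sphere, but for open E Fatou's lemma extends it to every c in (0,1).

  For sufficiency, substituting u = c t and using 1 - u^2 >= max(1 - c^2, 1 - t^2) reduces the claim
  to m(E)^p <= C (integral over E of phi^(p - 1) dm) with phi = t (1 - t^2)^(k/2), which holds
  because m{phi < l} <= C l. For necessity, let x tend to 0 in the following tests: E = (0,x) and
  c = x give g2 >= 1; E = (0,1/2) and E = (sqrt(1 - 2x), 1) with c = sqrt(1 - x) give the lower bounds
  of g1; E = (1/2 - x, 1/2) and c = 1/2 give k p >= 2.\<close>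

subsection \<open>Powers\<close>

lemma powr_ge_powr_abs:
  fixes z :: real
  assumes "0 < l" "l \<le> z" "z \<le> 1"
  shows "l powr \<bar>r\<bar> \<le> z powr r"
proof -
  have "l powr \<bar>r\<bar> \<le> z powr \<bar>r\<bar>" using assms by (intro powr_mono2) auto
  also have "\<dots> \<le> z powr r" using assms by (intro powr_mono') auto
  finally show ?thesis .
qed

lemma powr_le_powr_neg_abs:
  fixes z :: real
  assumes "0 < l" "l \<le> z" "z \<le> 1"
  shows "z powr r \<le> l powr (- \<bar>r\<bar>)"
  using powr_ge_powr_abs[OF assms, of "- r"] assms by (simp add: powr_minus inverse_le_imp_le)

lemma powr_le_powr_near_0_imp_exponent_le:
  fixes a b :: real
  assumes le: "\<And>x. 0 < x \<Longrightarrow> x < x0 \<Longrightarrow> K * x powr a \<le> L * x powr b"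
    and K: "K > 0" and x0: "x0 > 0"
  shows "b \<le> a"
proof (rule ccontr)
  assume "\<not> b \<le> a"
  then have "((\<lambda>x. L * x powr (b - a)) \<longlongrightarrow> L * 0 powr (b - a)) (at_right 0)"
    by (intro tendsto_intros) (auto simp: eventually_at_filter)
  moreover have "\<forall>\<^sub>F x in at_right 0. K \<le> L * x powr (b - a)"
    using eventually_at_right_real[OF x0]
  proof eventually_elim
    fix x assume "x \<in> {0<..<x0}"
    then show "K \<le> L * x powr (b - a)"
      using le[of x] by (simp add: powr_diff pos_le_divide_eq)
  qed
  ultimately have "K \<le> 0"
    using tendsto_lowerbound[of _ _ "at_right (0::real)" K] by fastforce
  then show False using K by simp
qed

lemma epowr_ennreal: "0 \<le> x \<Longrightarrow> epowr (ennreal x) a = ennreal (x powr a)"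
  by (simp add: epowr_def)

lemma epowr_mono:
  assumes "x \<le> y" "0 \<le> a"
  shows "epowr x a \<le> epowr y a"
proof (cases "y = \<infinity>")
  case False
  then obtain r s where "x = ennreal r" "0 \<le> r" "y = ennreal s" "0 \<le> s"
    using assms(1) by (cases x; cases y) (auto simp: top_unique)
  then show ?thesis using assms by (auto simp: epowr_ennreal intro!: ennreal_leI powr_mono2)
qed (simp add: epowr_def)

lemma epowr_cmult:
  assumes "0 < c"
  shows "epowr (ennreal c * x) a = ennreal (c powr a) * epowr x a"
proof (cases x)
  case (real r)
  then show ?thesis using assms
    by (simp add: ennreal_mult'[symmetric] epowr_ennreal powr_mult)
next
  case top
  then show ?thesis using assms by (simp add: epowr_def ennreal_mult_top)
qed

subsection \<open>Measures on the interval of heights\<close>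

definition height_measure :: "real \<Rightarrow> real \<Rightarrow> real measure" where
  "height_measure A q = density lborel
     (\<lambda>t. ennreal ((1 - t\<^sup>2) powr (A / 2 - 1) * t powr q) * indicator {0<..<1} t)"

lemma sets_height_measure [simp, measurable_cong]: "sets (height_measure A q) = sets borel"
  by (simp add: height_measure_def)

lemma space_height_measure [simp]: "space (height_measure A q) = UNIV"
  by (simp add: height_measure_def)

lemma nn_integral_height_measure:
  assumes [measurable]: "g \<in> borel_measurable borel"
  shows "(\<integral>\<^sup>+t. g t \<partial>height_measure A q) =
    (\<integral>\<^sup>+t. g t * (ennreal ((1 - t\<^sup>2) powr (A / 2 - 1) * t powr q) * indicator {0<..<1} t) \<partial>lborel)"
  unfolding height_measure_def by (subst nn_integral_density) (auto simp: mult.commute)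

lemma emeasure_height_measure:
  assumes [measurable]: "E \<in> sets borel"
  shows "emeasure (height_measure A q) E =
    (\<integral>\<^sup>+t. ennreal ((1 - t\<^sup>2) powr (A / 2 - 1) * t powr q) * indicator (E \<inter> {0<..<1}) t \<partial>lborel)"
  unfolding height_measure_def
  by (subst emeasure_density) (auto intro!: nn_integral_cong simp: indicator_def)

lemma emeasure_height_measure_mono:
  assumes "E \<inter> {0<..<1} \<subseteq> E'" "E \<in> sets borel" "E' \<in> sets borel"
  shows "emeasure (height_measure A q) E \<le> emeasure (height_measure A q) E'"
  unfolding emeasure_height_measure[OF assms(2)] emeasure_height_measure[OF assms(3)]
  using assms(1) by (intro nn_integral_mono) (auto simp: indicator_def)

lemma one_minus_square_pos: "0 < t \<Longrightarrow> t < 1 \<Longrightarrow> 0 < 1 - t\<^sup>2" for t :: real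
  by (simp add: power_less_one_iff)

lemma one_minus_square_ge: "0 \<le> t \<Longrightarrow> t \<le> 1 / 2 \<Longrightarrow> 3 / 4 \<le> 1 - t\<^sup>2" for t :: real
  using power_mono[of t "1 / 2" 2] by (simp add: power2_eq_square)

lemma nn_integral_height_tail:
  fixes k \<tau> :: real
  assumes k: "k > 0" and \<tau>: "0 \<le> \<tau>" "\<tau> \<le> 1"
  shows "(\<integral>\<^sup>+t. ennreal (2 * t * (1 - t\<^sup>2) powr (k / 2 - 1)) * indicator {\<tau><..<1} t \<partial>lborel)
    = ennreal (2 / k * (1 - \<tau>\<^sup>2) powr (k / 2))"
proof -
  have "((\<lambda>t. 2 * t * (1 - t\<^sup>2) powr (k / 2 - 1)) has_integral
      (- (2 / k) * (1 - 1\<^sup>2) powr (k / 2)) - (- (2 / k) * (1 - \<tau>\<^sup>2) powr (k / 2))) {\<tau>..1}"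
  proof (rule fundamental_theorem_of_calculus_interior)
    show "continuous_on {\<tau>..1} (\<lambda>t. - (2 / k) * (1 - t\<^sup>2) powr (k / 2))"
      using \<tau> k by (intro continuous_intros continuous_on_powr') (auto simp: power_le_one)
    fix t assume t: "t \<in> {\<tau><..<1}"
    have "1 - t\<^sup>2 > 0" using t \<tau> by (intro one_minus_square_pos) auto
    then have "((\<lambda>t. - (2 / k) * (1 - t\<^sup>2) powr (k / 2)) has_real_derivative
        2 * t * (1 - t\<^sup>2) powr (k / 2 - 1)) (at t)"
      using k by (auto intro!: derivative_eq_intros)
    then show "((\<lambda>t. - (2 / k) * (1 - t\<^sup>2) powr (k / 2)) has_vector_derivative
        2 * t * (1 - t\<^sup>2) powr (k / 2 - 1)) (at t)"
      by (rule has_real_derivative_iff_has_vector_derivative[THEN iffD1])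
  qed (use \<tau> in auto)
  then have "((\<lambda>t. 2 * t * (1 - t\<^sup>2) powr (k / 2 - 1)) has_integral
      2 / k * (1 - \<tau>\<^sup>2) powr (k / 2)) {\<tau><..<1}"
    by (simp add: has_integral_Icc_iff_Ioo)
  from nn_integral_has_integral_lebesgue'[OF _ this] \<tau> show ?thesis
    by auto
qed

lemma emeasure_height_measure_tail_le:
  assumes "A > 0" "q \<ge> 0" and \<tau>: "1 / 2 \<le> \<tau>" "\<tau> \<le> 1"
  shows "emeasure (height_measure A q) {\<tau><..} \<le> ennreal (2 / A * (1 - \<tau>\<^sup>2) powr (A / 2))"
proof -
  have "emeasure (height_measure A q) {\<tau><..}
    \<le> (\<integral>\<^sup>+t. ennreal (2 * t * (1 - t\<^sup>2) powr (A / 2 - 1)) * indicator {\<tau><..<1} t \<partial>lborel)"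
    unfolding emeasure_height_measure[OF borel_open[OF open_greaterThan]]
  proof (rule nn_integral_mono)
    fix t :: real
    have "(1 - t\<^sup>2) powr (A / 2 - 1) * t powr q \<le> 2 * t * (1 - t\<^sup>2) powr (A / 2 - 1)"
      if "\<tau> < t" "t < 1"
    proof -
      have "t powr q \<le> 2 * t" using that \<tau> assms powr_le1[of q t] by linarith
      then show ?thesis by (metis mult.commute mult_right_mono powr_ge_zero)
    qed
    then show "ennreal ((1 - t\<^sup>2) powr (A / 2 - 1) * t powr q) * indicator ({\<tau><..} \<inter> {0<..<1}) t
      \<le> ennreal (2 * t * (1 - t\<^sup>2) powr (A / 2 - 1)) * indicator {\<tau><..<1} t"
      by (auto simp: indicator_def intro: ennreal_leI)
  qed
  then show ?thesis using nn_integral_height_tail[of A \<tau>] assms by simp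
qed

lemma emeasure_height_measure_tail_ge:
  assumes k: "k > 0" and \<tau>: "0 \<le> \<tau>" "\<tau> \<le> 1"
  shows "ennreal ((1 - \<tau>\<^sup>2) powr (k / 2) / k) \<le> emeasure (height_measure k 0) {\<tau><..<1}"
proof -
  have "2 * ennreal ((1 - \<tau>\<^sup>2) powr (k / 2) / k) = ennreal (2 / k * (1 - \<tau>\<^sup>2) powr (k / 2))"
    using k by (simp add: ennreal_mult'' ennreal_mult[symmetric] flip: ennreal_numeral)
  also have "\<dots> = (\<integral>\<^sup>+t. ennreal (2 * t * (1 - t\<^sup>2) powr (k / 2 - 1)) * indicator {\<tau><..<1} t \<partial>lborel)"
    using nn_integral_height_tail[OF assms] by simp
  also have "\<dots> \<le> (\<integral>\<^sup>+t. 2 * (ennreal ((1 - t\<^sup>2) powr (k / 2 - 1) * t powr 0) *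
      indicator ({\<tau><..<1} \<inter> {0<..<1}) t) \<partial>lborel)"
    using \<tau> by (intro nn_integral_mono)
      (auto simp: indicator_def ennreal_mult[symmetric] mult_left_le_one_le intro!: ennreal_leI
        simp flip: ennreal_numeral)
  also have "\<dots> = 2 * emeasure (height_measure k 0) {\<tau><..<1}"
    by (simp add: emeasure_height_measure nn_integral_cmult)
  finally show ?thesis
    by (simp add: ennreal_mult_le_mult_iff)
qed

lemma emeasure_height_measure_interval_le:
  assumes "0 \<le> l" "l \<le> u" "u \<le> 1 / 2" "0 \<le> q"
  shows "emeasure (height_measure A q) {l..u}
    \<le> ennreal ((3 / 4) powr (- \<bar>A / 2 - 1\<bar>) * u powr q * (u - l))"
proof -
  let ?B = "(3 / 4) powr (- \<bar>A / 2 - 1\<bar>) * u powr q"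
  have "(1 - t\<^sup>2) powr (A / 2 - 1) * t powr q \<le> ?B" if "0 < t" "t \<le> u" for t
    using that assms one_minus_square_ge[of t] by (intro mult_mono powr_le_powr_neg_abs powr_mono2) auto
  then have "emeasure (height_measure A q) {l..u} \<le> (\<integral>\<^sup>+t. ennreal ?B * indicator {l..u} t \<partial>lborel)"
    by (auto simp: emeasure_height_measure indicator_def intro!: nn_integral_mono ennreal_leI)
  also have "\<dots> = ennreal (?B * (u - l))"
    using assms by (simp add: nn_integral_cmult ennreal_mult'[symmetric])
  finally show ?thesis .
qed

lemma emeasure_height_measure_interval_ge:
  assumes "0 \<le> l" "l \<le> u" "u \<le> 1 / 2"
  shows "ennreal ((3 / 4) powr \<bar>k / 2 - 1\<bar> * (u - l)) \<le> emeasure (height_measure k 0) {l<..<u}"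
proof -
  let ?B = "(3 / 4) powr \<bar>k / 2 - 1\<bar> :: real"
  have "?B \<le> (1 - t\<^sup>2) powr (k / 2 - 1)" if "0 < t" "t < u" for t
    using that assms one_minus_square_ge[of t] by (intro powr_ge_powr_abs) auto
  then have "(\<integral>\<^sup>+t. ennreal ?B * indicator {l<..<u} t \<partial>lborel) \<le> emeasure (height_measure k 0) {l<..<u}"
    using assms by (auto simp: emeasure_height_measure indicator_def intro!: nn_integral_mono ennreal_leI)
  then show ?thesis
    using assms by (simp add: nn_integral_cmult ennreal_mult'[symmetric])
qed

lemma finite_height_measure:
  assumes "A > 0" "q \<ge> 0"
  shows "finite_measure (height_measure A q)"
proof (rule finite_measureI)
  have "emeasure (height_measure A q) UNIV \<le> emeasure (height_measure A q) ({0..1 / 2} \<union> {1 / 2<..})"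
    by (rule emeasure_height_measure_mono) auto
  also have "\<dots> \<le> emeasure (height_measure A q) {0..1 / 2} + emeasure (height_measure A q) {1 / 2<..}"
    by (rule emeasure_subadditive) auto
  also have "\<dots> < top"
    using emeasure_height_measure_interval_le[of 0 "1 / 2" q A]
      emeasure_height_measure_tail_le[of A q "1 / 2"] assms
    by (auto intro: le_less_trans)
  finally show "emeasure (height_measure A q) (space (height_measure A q)) \<noteq> \<infinity>" by simp
qed

text \<open>Up to constants, \<open>edge_mass k t\<close> is the mass of \<open>height_measure k 0\<close> between \<open>t\<close> and the
  nearer endpoint of the unit interval.\<close>
definition edge_mass :: "real \<Rightarrow> real \<Rightarrow> real" where
  "edge_mass k t = t * (1 - t\<^sup>2) powr (k / 2)"

lemma borel_measurable_edge_mass [measurable]: "edge_mass k \<in> borel_measurable borel"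
  unfolding edge_mass_def[abs_def] by measurable

lemma edge_mass_less_imp_near_endpoint:
  fixes k l t :: real
  assumes "k > 0" and t: "0 < t" "t < 1" and l: "edge_mass k t < l"
  shows "t \<le> min ((4 / 3) powr (k / 2) * l) (1 / 2) \<or>
      max (1 / 2) (sqrt (1 - min 1 ((2 * l) powr (2 / k)))) < t"
proof (cases "t \<le> 1 / 2")
  case True
  then have "t * (3 / 4) powr (k / 2) \<le> edge_mass k t"
    unfolding edge_mass_def using assms one_minus_square_ge[of t] by (intro mult_left_mono powr_mono2) auto
  then have "t * (3 / 4) powr (k / 2) * (4 / 3) powr (k / 2) \<le> l * (4 / 3) powr (k / 2)"
    using l by (intro mult_right_mono) auto
  then show ?thesis
    using True by (simp add: mult.assoc powr_mult[symmetric] mult.commute[of l])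
next
  case False
  then have "(1 / 2) * (1 - t\<^sup>2) powr (k / 2) \<le> edge_mass k t"
    unfolding edge_mass_def by (intro mult_right_mono) auto
  then have "((1 - t\<^sup>2) powr (k / 2)) powr (2 / k) < (2 * l) powr (2 / k)"
    using assms by (intro powr_less_mono2) auto
  then have "1 - min 1 ((2 * l) powr (2 / k)) < t\<^sup>2"
    using one_minus_square_pos[OF t] assms by (simp add: powr_powr min_def)
  then have "sqrt (1 - min 1 ((2 * l) powr (2 / k))) < t" using t by (intro real_less_lsqrt) auto
  then show ?thesis using False by simp
qed

lemma emeasure_edge_mass_less_le:
  fixes k :: real
  assumes k: "k > 0"
  obtains C :: real where "C > 0"
    "\<And>l. l > 0 \<Longrightarrow> emeasure (height_measure k 0) {t. edge_mass k t < l} \<le> ennreal (C * l)"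
proof
  define \<kappa> where "\<kappa> = (4 / 3 :: real) powr (k / 2)"
  define J where "J = (3 / 4 :: real) powr (- \<bar>k / 2 - 1\<bar>)"
  show "J * \<kappa> + 4 / k > 0" using k by (simp add: J_def \<kappa>_def add_pos_pos)
  fix l :: real assume l: "l > 0"
  define r where "r = (2 * l) powr (2 / k)"
  define u \<tau> where "u = min (\<kappa> * l) (1 / 2)" and "\<tau> = max (1 / 2) (sqrt (1 - min 1 r))"
  have r: "r > 0" and u: "0 \<le> u" "u \<le> \<kappa> * l" "u \<le> 1 / 2" using l by (auto simp: r_def u_def \<kappa>_def)
  then have \<tau>: "1 / 2 \<le> \<tau>" "\<tau> \<le> 1" by (auto simp: \<tau>_def)
  have near_0: "emeasure (height_measure k 0) {0..u} \<le> ennreal (J * (\<kappa> * l))"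
  proof -
    have "J * u powr 0 * u \<le> J * (\<kappa> * l)"
      using u by (auto simp: J_def intro!: mult_mono)
    then show ?thesis
      using emeasure_height_measure_interval_le[of 0 u 0 k] u
      by (auto simp: J_def intro: order_trans ennreal_leI)
  qed
  have near_1: "emeasure (height_measure k 0) {\<tau><..} \<le> ennreal (2 / k * (2 * l))"
  proof -
    have "1 - \<tau>\<^sup>2 \<le> min 1 r"
      using power_mono[of "sqrt (1 - min 1 r)" \<tau> 2] by (simp add: \<tau>_def)
    then have "(1 - \<tau>\<^sup>2) powr (k / 2) \<le> r powr (k / 2)"
      using \<tau> k by (intro powr_mono2) (auto simp: power_le_one)
    also have "\<dots> = 2 * l" using k l by (simp add: r_def powr_powr)
    finally have "2 / k * (1 - \<tau>\<^sup>2) powr (k / 2) \<le> 2 / k * (2 * l)"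
      using k by (intro mult_left_mono) auto
    then show ?thesis
      using emeasure_height_measure_tail_le[of k 0 \<tau>] k \<tau> by (auto intro: order_trans ennreal_leI)
  qed
  have "emeasure (height_measure k 0) {t. edge_mass k t < l}
    \<le> emeasure (height_measure k 0) ({0..u} \<union> {\<tau><..})"
    using edge_mass_less_imp_near_endpoint[OF k, of _ l]
    by (intro emeasure_height_measure_mono) (force simp: u_def \<tau>_def r_def \<kappa>_def)+
  also have "\<dots> \<le> emeasure (height_measure k 0) {0..u} + emeasure (height_measure k 0) {\<tau><..}"
    by (rule emeasure_subadditive) auto
  also have "\<dots> \<le> ennreal (J * (\<kappa> * l)) + ennreal (2 / k * (2 * l))"
    using near_0 near_1 by (rule add_mono)
  also have "\<dots> = ennreal ((J * \<kappa> + 4 / k) * l)"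
    using k l by (subst ennreal_plus[symmetric]) (auto simp: J_def \<kappa>_def algebra_simps)
  finally show "emeasure (height_measure k 0) {t. edge_mass k t < l} \<le> ennreal ((J * \<kappa> + 4 / k) * l)" .
qed

subsection \<open>The dilation estimate: sufficient conditions\<close>

text \<open>The estimate for great spheres at distance \<open>arccos c\<close> from the origin, tested on the indicators of
  the sets of heights in \<open>S\<close>.\<close>
definition dilation_estimate :: "real set set \<Rightarrow> real \<Rightarrow> real \<Rightarrow> real \<Rightarrow> real \<Rightarrow> real \<Rightarrow> bool" where
  "dilation_estimate S k A p \<gamma> \<delta> \<longleftrightarrow> (\<exists>K>0. \<forall>E\<in>S. \<forall>c\<in>{0<..<1}.
     ennreal (K * (1 - c\<^sup>2) powr (\<gamma> / 2) * c powr \<delta>) * emeasure (height_measure k 0) {t. c * t \<in> E}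
       \<le> epowr (emeasure (height_measure A (p - 1)) E) (1 / p))"

lemma measure_powr_le_nn_integral_powr:
  fixes \<phi> :: "'a \<Rightarrow> real"
  assumes "finite_measure M" and [measurable]: "\<phi> \<in> borel_measurable M" "E \<in> sets M" and C: "C > 0"
    and sublevel: "\<And>l. l > 0 \<Longrightarrow> emeasure M {x \<in> space M. \<phi> x < l} \<le> ennreal (C * l)"
    and q: "q \<ge> 0"
  shows "ennreal ((1 / (2 * C)) powr q / 2 * measure M E powr (q + 1))
    \<le> (\<integral>\<^sup>+x. ennreal (\<phi> x powr q) * indicator E x \<partial>M)"
proof (cases "measure M E = 0")
  case False
  interpret finite_measure M by fact
  define l where "l = measure M E / (2 * C)"
  have E: "measure M E > 0" using False by (simp add: zero_less_measure_iff)
  then have l: "l > 0" using C by (simp add: l_def)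
  define E' where "E' = {x \<in> space M. x \<in> E \<and> l \<le> \<phi> x}"
  have [measurable]: "E' \<in> sets M" unfolding E'_def by measurable
  have "measure M E \<le> measure M (E' \<union> {x \<in> space M. \<phi> x < l})"
    using sets.sets_into_space[OF assms(3)] by (intro finite_measure_mono) (auto simp: E'_def)
  also have "\<dots> \<le> measure M E' + measure M {x \<in> space M. \<phi> x < l}"
    by (rule measure_Un_le) measurable
  also have "measure M {x \<in> space M. \<phi> x < l} \<le> C * l"
    using sublevel[OF l] C l by (simp add: emeasure_eq_measure)
  finally have half: "measure M E / 2 \<le> measure M E'"
    using C by (simp add: l_def)
  have "(1 / (2 * C)) powr q / 2 * measure M E powr (q + 1) = l powr q * (measure M E / 2)"
    using E C by (simp add: l_def powr_add powr_divide powr_mult)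
  also have "\<dots> \<le> l powr q * measure M E'"
    using half by (intro mult_left_mono) auto
  also have "ennreal \<dots> = (\<integral>\<^sup>+x. ennreal (l powr q) * indicator E' x \<partial>M)"
    by (simp add: nn_integral_cmult emeasure_eq_measure ennreal_mult')
  also have "\<dots> \<le> (\<integral>\<^sup>+x. ennreal (\<phi> x powr q) * indicator E x \<partial>M)"
    using l q by (intro nn_integral_mono) (auto simp: E'_def indicator_def intro!: ennreal_leI powr_mono2)
  finally show ?thesis by (simp add: ennreal_leI)
qed simp

lemma emeasure_height_measure_dilation:
  assumes [measurable]: "E \<in> sets borel" and "0 < c"
  shows "emeasure (height_measure A q) E = ennreal c *
    (\<integral>\<^sup>+t. ennreal ((1 - (c * t)\<^sup>2) powr (A / 2 - 1) * (c * t) powr q) *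
      indicator (E \<inter> {0<..<1}) (c * t) \<partial>lborel)"
  unfolding emeasure_height_measure[OF assms(1)]
  using assms by (subst nn_integral_real_affine[where c = c and t = 0]) auto

text \<open>The weights are compared through \<open>1 - (c t)\<^sup>2 \<ge> max (1 - c\<^sup>2) (1 - t\<^sup>2)\<close>.\<close>
lemma height_density_dilation_ge:
  fixes c t A k p \<gamma> :: real
  assumes c: "0 < c" "c < 1" and t: "0 < t" "t < 1"
    and p: "p \<ge> 1" and kp: "k * p \<ge> 2" and \<gamma>: "\<gamma> \<ge> 0" "\<gamma> \<ge> A / p - k"
  shows "((1 - c\<^sup>2) powr (\<gamma> / 2)) powr p * c powr (p - 1) *
      (edge_mass k t powr (p - 1) * (1 - t\<^sup>2) powr (k / 2 - 1))
    \<le> (1 - (c * t)\<^sup>2) powr (A / 2 - 1) * (c * t) powr (p - 1)"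
proof -
  define x where "x = 1 - (c * t)\<^sup>2"
  note c_pos = one_minus_square_pos[OF c] and t_pos = one_minus_square_pos[OF t]
  have "(c * t)\<^sup>2 \<le> c\<^sup>2" using c t by (intro power_mono) (auto simp: mult_le_cancel_left1)
  moreover have "(c * t)\<^sup>2 \<le> t\<^sup>2" using c t by (intro power_mono) (auto simp: mult_le_cancel_right1)
  ultimately have x: "0 < x" "x \<le> 1" "1 - c\<^sup>2 \<le> x" "1 - t\<^sup>2 \<le> x"
    using c_pos by (auto simp: x_def)
  have "((1 - c\<^sup>2) powr (\<gamma> / 2)) powr p * (1 - t\<^sup>2) powr (k * p / 2 - 1)
      = (1 - c\<^sup>2) powr (p * \<gamma> / 2) * (1 - t\<^sup>2) powr (k * p / 2 - 1)"
    by (simp add: powr_powr mult.commute)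
  also have "\<dots> \<le> x powr (p * \<gamma> / 2) * x powr (k * p / 2 - 1)"
    using x c_pos t_pos p \<gamma> kp by (intro mult_mono powr_mono2) auto
  also have "\<dots> = x powr (p * \<gamma> / 2 + (k * p / 2 - 1))" by (simp add: powr_add)
  also have "\<dots> \<le> x powr (A / 2 - 1)"
  proof (rule powr_mono')
    have "A \<le> p * (\<gamma> + k)" using \<gamma>(2) p by (simp add: field_simps)
    then show "A / 2 - 1 \<le> p * \<gamma> / 2 + (k * p / 2 - 1)" by (simp add: algebra_simps)
  qed (use x in auto)
  finally have weights: "((1 - c\<^sup>2) powr (\<gamma> / 2)) powr p * (1 - t\<^sup>2) powr (k * p / 2 - 1)
      \<le> x powr (A / 2 - 1)" .
  have "edge_mass k t powr (p - 1) * (1 - t\<^sup>2) powr (k / 2 - 1) =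
      t powr (p - 1) * (1 - t\<^sup>2) powr (k / 2 * (p - 1) + (k / 2 - 1))"
    using t t_pos by (simp add: edge_mass_def powr_mult powr_powr powr_add)
  also have "k / 2 * (p - 1) + (k / 2 - 1) = k * p / 2 - 1" by (simp add: field_simps)
  finally have "((1 - c\<^sup>2) powr (\<gamma> / 2)) powr p * c powr (p - 1) *
      (edge_mass k t powr (p - 1) * (1 - t\<^sup>2) powr (k / 2 - 1)) =
    (((1 - c\<^sup>2) powr (\<gamma> / 2)) powr p * (1 - t\<^sup>2) powr (k * p / 2 - 1)) * (c * t) powr (p - 1)"
    using c t by (simp add: powr_mult)
  also have "\<dots> \<le> x powr (A / 2 - 1) * (c * t) powr (p - 1)"
    using weights by (rule mult_right_mono) simp
  finally show ?thesis by (simp add: x_def)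
qed

lemma nn_integral_edge_mass_powr_le:
  fixes k p A c \<gamma> :: real
  assumes p: "p \<ge> 1" and kp: "k * p \<ge> 2" and c: "0 < c" "c < 1"
    and \<gamma>: "\<gamma> \<ge> 0" "\<gamma> \<ge> A / p - k" and E[measurable]: "E \<in> sets borel"
  shows "ennreal (((1 - c\<^sup>2) powr (\<gamma> / 2) * c) powr p) *
      (\<integral>\<^sup>+t. ennreal (edge_mass k t powr (p - 1)) * indicator {t. c * t \<in> E} t \<partial>height_measure k 0)
    \<le> emeasure (height_measure A (p - 1)) E"
proof -
  define s where "s = ((1 - c\<^sup>2) powr (\<gamma> / 2)) powr p * c powr (p - 1)"
  have [measurable]: "{t. c * t \<in> E} \<in> sets borel" by measurable
  have "((1 - c\<^sup>2) powr (\<gamma> / 2) * c) powr p = c * s"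
    using c by (simp add: s_def powr_mult powr_diff)
  then have "ennreal (((1 - c\<^sup>2) powr (\<gamma> / 2) * c) powr p) *
      (\<integral>\<^sup>+t. ennreal (edge_mass k t powr (p - 1)) * indicator {t. c * t \<in> E} t \<partial>height_measure k 0)
    = ennreal c * (\<integral>\<^sup>+t. ennreal s * (ennreal (edge_mass k t powr (p - 1)) * indicator {t. c * t \<in> E} t *
       (ennreal ((1 - t\<^sup>2) powr (k / 2 - 1) * t powr 0) * indicator {0<..<1} t)) \<partial>lborel)"
    using c by (simp add: nn_integral_height_measure nn_integral_cmult ennreal_mult' mult.assoc)
  also have "\<dots> \<le> ennreal c * (\<integral>\<^sup>+t. ennreal ((1 - (c * t)\<^sup>2) powr (A / 2 - 1) * (c * t) powr (p - 1)) *
      indicator (E \<inter> {0<..<1}) (c * t) \<partial>lborel)"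
  proof (intro mult_left_mono nn_integral_mono)
    fix t :: real
    show "ennreal s * (ennreal (edge_mass k t powr (p - 1)) * indicator {t. c * t \<in> E} t *
        (ennreal ((1 - t\<^sup>2) powr (k / 2 - 1) * t powr 0) * indicator {0<..<1} t))
      \<le> ennreal ((1 - (c * t)\<^sup>2) powr (A / 2 - 1) * (c * t) powr (p - 1)) * indicator (E \<inter> {0<..<1}) (c * t)"
    proof (cases "0 < t \<and> t < 1 \<and> c * t \<in> E")
      case True
      then have "0 < c * t" "c * t < 1" using c mult_strict_mono[of c 1 t 1] by auto
      then show ?thesis
        using True height_density_dilation_ge[OF c _ _ p kp \<gamma>, of t]
        by (simp add: s_def ennreal_mult'[symmetric] ennreal_leI)
    qed (auto simp: indicator_def)
  qed auto
  also have "\<dots> = emeasure (height_measure A (p - 1)) E"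
    using c by (simp add: emeasure_height_measure_dilation[of E c])
  finally show ?thesis .
qed

lemma dilation_estimate_sufficient:
  fixes k p A \<gamma> \<delta> :: real
  assumes k: "k > 0" and p: "p \<ge> 1" and kp: "k * p \<ge> 2"
    and \<gamma>: "\<gamma> \<ge> 0" "\<gamma> \<ge> A / p - k" and \<delta>: "\<delta> \<ge> 1"
  shows "dilation_estimate (sets borel) k A p \<gamma> \<delta>"
proof -
  interpret finite_measure "height_measure k 0" using k by (intro finite_height_measure) auto
  obtain C where C: "C > 0"
    "\<And>l. l > 0 \<Longrightarrow> emeasure (height_measure k 0) {t. edge_mass k t < l} \<le> ennreal (C * l)"
    using emeasure_edge_mass_less_le[OF k] by metis
  define L where "L = (1 / (2 * C)) powr (p - 1) / 2"
  have L: "L > 0" using C by (simp add: L_def)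
  have "ennreal (L powr (1 / p) * (1 - c\<^sup>2) powr (\<gamma> / 2) * c powr \<delta>) *
      emeasure (height_measure k 0) {t. c * t \<in> E}
      \<le> epowr (emeasure (height_measure A (p - 1)) E) (1 / p)"
    if E[measurable]: "E \<in> sets borel" and c: "0 < c" "c < 1" for E c
  proof -
    define s where "s = (1 - c\<^sup>2) powr (\<gamma> / 2) * c"
    define m where "m = measure (height_measure k 0) {t. c * t \<in> E}"
    have s: "s \<ge> 0" using c by (simp add: s_def)
    have "ennreal (L * (s * m) powr p) = ennreal (s powr p) * ennreal (L * m powr ((p - 1) + 1))"
      using L s by (simp add: ennreal_mult'[symmetric] powr_mult m_def)
    also have "\<dots> \<le> ennreal (s powr p) *
        (\<integral>\<^sup>+t. ennreal (edge_mass k t powr (p - 1)) * indicator {t. c * t \<in> E} t \<partial>height_measure k 0)"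
      unfolding L_def m_def using C p finite_measure_axioms
      by (intro mult_left_mono measure_powr_le_nn_integral_powr) auto
    also have "\<dots> \<le> emeasure (height_measure A (p - 1)) E"
      unfolding s_def using p kp c \<gamma> E by (rule nn_integral_edge_mass_powr_le)
    finally have "epowr (ennreal (L * (s * m) powr p)) (1 / p)
        \<le> epowr (emeasure (height_measure A (p - 1)) E) (1 / p)"
      using p by (intro epowr_mono) auto
    moreover have "epowr (ennreal (L * (s * m) powr p)) (1 / p) = ennreal (L powr (1 / p) * (s * m))"
      using L p s by (simp add: epowr_ennreal powr_mult powr_powr m_def)
    moreover have "L powr (1 / p) * (1 - c\<^sup>2) powr (\<gamma> / 2) * c powr \<delta> * m \<le> L powr (1 / p) * (s * m)"
      using c \<delta> powr_mono'[of 1 \<delta> c]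
      by (auto simp: s_def m_def mult.assoc intro!: mult_left_mono mult_right_mono)
    ultimately show ?thesis
      by (simp add: emeasure_eq_measure m_def ennreal_mult'[symmetric] order_trans[OF ennreal_leI])
  qed
  then show ?thesis
    unfolding dilation_estimate_def using L by (intro exI[of _ "L powr (1 / p)"]) auto
qed

subsection \<open>The dilation estimate: necessary conditions\<close>

lemma dilation_estimate_exponents_le:
  fixes E :: "real \<Rightarrow> real set" and c :: "real \<Rightarrow> real"
  assumes estimate: "dilation_estimate S k A p \<gamma> \<delta>" and p: "p \<ge> 1"
    and E: "\<And>x. 0 < x \<Longrightarrow> x < x0 \<Longrightarrow> E x \<in> S" and c: "\<And>x. 0 < x \<Longrightarrow> x < x0 \<Longrightarrow> 0 < c x \<and> c x < 1"
    and weight: "\<And>x. 0 < x \<Longrightarrow> x < x0 \<Longrightarrow> w * x powr a \<le> (1 - (c x)\<^sup>2) powr (\<gamma> / 2) * c x powr \<delta>"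
    and lower: "\<And>x. 0 < x \<Longrightarrow> x < x0 \<Longrightarrow> ennreal (m * x powr b)
        \<le> emeasure (height_measure k 0) {t. c x * t \<in> E x}"
    and upper: "\<And>x. 0 < x \<Longrightarrow> x < x0 \<Longrightarrow> emeasure (height_measure A (p - 1)) (E x) \<le> ennreal (B * x powr d)"
    and pos: "x0 > 0" "w > 0" "m > 0" "B > 0"
  shows "d / p \<le> a + b"
proof -
  obtain K where K: "K > 0" and test: "\<And>E c. E \<in> S \<Longrightarrow> c \<in> {0<..<1} \<Longrightarrow>
     ennreal (K * (1 - c\<^sup>2) powr (\<gamma> / 2) * c powr \<delta>) * emeasure (height_measure k 0) {t. c * t \<in> E}
       \<le> epowr (emeasure (height_measure A (p - 1)) E) (1 / p)"
    using estimate unfolding dilation_estimate_def by blast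
  show ?thesis
  proof (rule powr_le_powr_near_0_imp_exponent_le)
    fix x assume x: "0 < x" "x < x0"
    have "K * (w * x powr a) \<le> K * (1 - (c x)\<^sup>2) powr (\<gamma> / 2) * c x powr \<delta>"
      using K weight[OF x] by (simp add: mult.assoc)
    then have "ennreal (K * (w * x powr a)) * ennreal (m * x powr b)
        \<le> ennreal (K * (1 - (c x)\<^sup>2) powr (\<gamma> / 2) * c x powr \<delta>) *
          emeasure (height_measure k 0) {t. c x * t \<in> E x}"
      using lower[OF x] by (intro mult_mono[OF ennreal_leI]) auto
    also have "\<dots> \<le> epowr (emeasure (height_measure A (p - 1)) (E x)) (1 / p)"
      using E[OF x] c[OF x] by (intro test) auto
    also have "\<dots> \<le> epowr (ennreal (B * x powr d)) (1 / p)"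
      using upper[OF x] p by (intro epowr_mono) auto
    also have "\<dots> = ennreal (B powr (1 / p) * x powr (d / p))"
      using pos by (simp add: epowr_ennreal powr_mult powr_powr)
    finally show "K * w * m * x powr (a + b) \<le> B powr (1 / p) * x powr (d / p)"
      using pos K by (simp add: ennreal_mult'[symmetric] powr_add mult_ac)
  qed (use pos K in auto)
qed

lemma dilation_estimate_imp_cos_exponent_ge:
  assumes "dilation_estimate (Collect open) k A p \<gamma> \<delta>" and k: "k > 0" and p: "p \<ge> 1"
  shows "\<delta> \<ge> 1"
proof -
  let ?J = "(3 / 4) powr (- \<bar>A / 2 - 1\<bar>) :: real"
  have "p / p \<le> \<delta> + 0"
  proof (rule dilation_estimate_exponents_le[OF assms(1) p, where E = "\<lambda>x. {0<..<x}" and c = "\<lambda>x. x"])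
    fix x :: real assume x: "0 < x" "x < 1 / 2"
    show "(3 / 4) powr \<bar>\<gamma> / 2\<bar> * x powr \<delta> \<le> (1 - x\<^sup>2) powr (\<gamma> / 2) * x powr \<delta>"
      using x one_minus_square_ge[of x] by (intro mult_right_mono powr_ge_powr_abs) auto
    have "{t. x * t \<in> {0<..<x}} = {0<..<1}" using x by (auto simp: zero_less_mult_iff)
    then show "ennreal (1 / k * x powr 0) \<le> emeasure (height_measure k 0) {t. x * t \<in> {0<..<x}}"
      using x emeasure_height_measure_tail_ge[OF k, of 0] by simp
    have "emeasure (height_measure A (p - 1)) {0<..<x} \<le> emeasure (height_measure A (p - 1)) {0..x}"
      by (rule emeasure_mono) auto
    also have "\<dots> \<le> ennreal (?J * x powr (p - 1) * (x - 0))"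
      using x p by (intro emeasure_height_measure_interval_le) auto
    also have "?J * x powr (p - 1) * (x - 0) = ?J * x powr p" using x by (simp add: powr_diff)
    finally show "emeasure (height_measure A (p - 1)) {0<..<x} \<le> ennreal (?J * x powr p)" .
  qed (use k in auto)
  then show ?thesis using p by simp
qed

lemma sin_cos_weight_near_pole_ge:
  fixes x :: real
  assumes "0 < x" "x < 3 / 4"
  shows "(1 / 2) powr \<bar>\<delta>\<bar> * x powr (\<gamma> / 2) \<le> (1 - (sqrt (1 - x))\<^sup>2) powr (\<gamma> / 2) * sqrt (1 - x) powr \<delta>"
proof -
  have "(1 / 2) powr \<bar>\<delta>\<bar> \<le> sqrt (1 - x) powr \<delta>"
    using assms by (intro powr_ge_powr_abs real_le_rsqrt) (auto simp: power2_eq_square)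
  then show ?thesis using assms by (simp add: mult.commute mult_left_mono)
qed

lemma dilation_estimate_imp_sin_exponent_nonneg:
  assumes "dilation_estimate (Collect open) k A p \<gamma> \<delta>" and p: "p \<ge> 1"
  shows "\<gamma> \<ge> 0"
proof -
  let ?J = "(3 / 4) powr (- \<bar>A / 2 - 1\<bar>) * (1 / 2) powr (p - 1) * (1 / 2 - 0) :: real"
  let ?m = "(3 / 4) powr \<bar>k / 2 - 1\<bar> * (1 / 2 - 0) :: real"
  have "0 / p \<le> \<gamma> / 2 + 0"
  proof (rule dilation_estimate_exponents_le[OF assms(1) p, where E = "\<lambda>_. {0<..<1 / 2}"
      and c = "\<lambda>x. sqrt (1 - x)"])
    fix x :: real assume x: "0 < x" "x < 3 / 4"
    then show "(1 / 2) powr \<bar>\<delta>\<bar> * x powr (\<gamma> / 2)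
        \<le> (1 - (sqrt (1 - x))\<^sup>2) powr (\<gamma> / 2) * sqrt (1 - x) powr \<delta>"
      by (rule sin_cos_weight_near_pole_ge)
    have "ennreal ?m \<le> emeasure (height_measure k 0) {0<..<1 / 2}"
      by (rule emeasure_height_measure_interval_ge) auto
    also have "\<dots> \<le> emeasure (height_measure k 0) {t. sqrt (1 - x) * t \<in> {0<..<1 / 2}}"
      using x mult_strict_mono[of "sqrt (1 - x)" 1 _ "1 / 2"] by (intro emeasure_mono) auto
    finally show "ennreal (?m * x powr 0)
        \<le> emeasure (height_measure k 0) {t. sqrt (1 - x) * t \<in> {0<..<1 / 2}}"
      using x by simp
    have "emeasure (height_measure A (p - 1)) {0<..<1 / 2} \<le> emeasure (height_measure A (p - 1)) {0..1 / 2}"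
      by (rule emeasure_mono) auto
    also have "\<dots> \<le> ennreal ?J"
      using p by (intro emeasure_height_measure_interval_le) auto
    finally show "emeasure (height_measure A (p - 1)) {0<..<1 / 2} \<le> ennreal (?J * x powr 0)"
      using x by simp
  qed auto
  then show ?thesis by simp
qed

lemma dilation_estimate_imp_dimension_ge:
  assumes "dilation_estimate (Collect open) k A p \<gamma> \<delta>" and k: "k > 0" and p: "p \<ge> 1"
  shows "k * p \<ge> 2"
proof -
  let ?J = "(3 / 4) powr (- \<bar>A / 2 - 1\<bar>) * (1 / 2) powr (p - 1) :: real"
  have "1 / p \<le> 0 + k / 2"
  proof (rule dilation_estimate_exponents_le[OF assms(1) p, where E = "\<lambda>x. {1 / 2 - x<..<1 / 2}"
      and c = "\<lambda>_. 1 / 2"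
        and w = "(1 - (1 / 2)\<^sup>2) powr (\<gamma> / 2) * (1 / 2) powr \<delta>"])
    fix x :: real assume x: "0 < x" "x < 1 / 2"
    show "ennreal (1 / k * x powr (k / 2))
        \<le> emeasure (height_measure k 0) {t. 1 / 2 * t \<in> {1 / 2 - x<..<1 / 2}}"
    proof -
      have "x \<le> 1 - (1 - 2 * x)\<^sup>2" using x mult_left_mono[of x "1 / 2" x]
        by (simp add: power2_eq_square algebra_simps)
      then have "1 / k * x powr (k / 2) \<le> (1 - (1 - 2 * x)\<^sup>2) powr (k / 2) / k"
        using x k by (auto intro!: divide_right_mono powr_mono2)
      moreover have "{t. 1 / 2 * t \<in> {1 / 2 - x<..<1 / 2}} = {1 - 2 * x<..<1}" by auto
      ultimately show ?thesis
        using x emeasure_height_measure_tail_ge[OF k, of "1 - 2 * x"]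
        by (auto intro: order_trans ennreal_leI)
    qed
    have "emeasure (height_measure A (p - 1)) {1 / 2 - x<..<1 / 2}
        \<le> emeasure (height_measure A (p - 1)) {1 / 2 - x..1 / 2}"
      by (rule emeasure_mono) auto
    also have "\<dots> \<le> ennreal (?J * (1 / 2 - (1 / 2 - x)))"
      using x p by (intro emeasure_height_measure_interval_le) auto
    finally show "emeasure (height_measure A (p - 1)) {1 / 2 - x<..<1 / 2} \<le> ennreal (?J * x powr 1)"
      using x by simp
  qed (use k in \<open>auto simp: power2_eq_square\<close>)
  then show ?thesis using p by (simp add: field_simps)
qed

lemma dilation_estimate_imp_sin_exponent_ge:
  assumes "dilation_estimate (Collect open) k A p \<gamma> \<delta>" and k: "k > 0" and p: "p \<ge> 1" and A: "A > 0"
  shows "\<gamma> \<ge> A / p - k"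
proof -
  have "A / 2 / p \<le> \<gamma> / 2 + k / 2"
  proof (rule dilation_estimate_exponents_le[OF assms(1) p,
      where E = "\<lambda>x. {sqrt (1 - 2 * x)<..}" and c = "\<lambda>x. sqrt (1 - x)"])
    fix x :: real assume x: "0 < x" "x < 3 / 8"
    then show "(1 / 2) powr \<bar>\<delta>\<bar> * x powr (\<gamma> / 2)
        \<le> (1 - (sqrt (1 - x))\<^sup>2) powr (\<gamma> / 2) * sqrt (1 - x) powr \<delta>"
      by (intro sin_cos_weight_near_pole_ge) auto
    show "ennreal (1 / k * x powr (k / 2))
        \<le> emeasure (height_measure k 0) {t. sqrt (1 - x) * t \<in> {sqrt (1 - 2 * x)<..}}"
    proof -
      define \<tau> where "\<tau> = sqrt (1 - 2 * x) / sqrt (1 - x)"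
      have \<tau>: "0 \<le> \<tau>" "\<tau> \<le> 1" using x by (auto simp: \<tau>_def)
      have "1 - \<tau>\<^sup>2 = x / (1 - x)" using x by (simp add: \<tau>_def power_divide field_simps)
      then have "x \<le> 1 - \<tau>\<^sup>2" using x by (simp add: pos_le_divide_eq mult_left_le)
      then have "1 / k * x powr (k / 2) \<le> (1 - \<tau>\<^sup>2) powr (k / 2) / k"
        using x k by (auto intro!: divide_right_mono powr_mono2)
      moreover have "emeasure (height_measure k 0) {\<tau><..<1}
          \<le> emeasure (height_measure k 0) {t. sqrt (1 - x) * t \<in> {sqrt (1 - 2 * x)<..}}"
        using x by (intro emeasure_mono) (auto simp: \<tau>_def field_simps)
      ultimately show ?thesis
        using emeasure_height_measure_tail_ge[OF k \<tau>] by (meson ennreal_leI order_trans)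
    qed
    have "emeasure (height_measure A (p - 1)) {sqrt (1 - 2 * x)<..}
        \<le> ennreal (2 / A * (1 - (sqrt (1 - 2 * x))\<^sup>2) powr (A / 2))"
      using x A p by (intro emeasure_height_measure_tail_le real_le_rsqrt) (auto simp: power2_eq_square)
    then show "emeasure (height_measure A (p - 1)) {sqrt (1 - 2 * x)<..}
        \<le> ennreal (2 / A * 2 powr (A / 2) * x powr (A / 2))"
      using x by (simp add: powr_mult mult.assoc)
  qed (use k A in auto)
  then show ?thesis using p by (simp add: field_simps)
qed

lemma dilation_estimate_necessary:
  assumes "dilation_estimate (Collect open) k A p \<gamma> \<delta>" and k: "k > 0" and p: "p \<ge> 1"
  shows "k * p \<ge> 2 \<and> \<delta> \<ge> 1 \<and> \<gamma> \<ge> max 0 (A / p - k)"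
proof -
  have "A / p - k \<le> \<gamma>"
  proof (cases "A > 0")
    case False
    then have "A / p \<le> 0" using p by (simp add: divide_nonpos_pos)
    then show ?thesis using dilation_estimate_imp_sin_exponent_nonneg[OF assms(1) p] k by linarith
  qed (rule dilation_estimate_imp_sin_exponent_ge[OF assms])
  then show ?thesis
    using dilation_estimate_imp_cos_exponent_ge dilation_estimate_imp_sin_exponent_nonneg
      dilation_estimate_imp_dimension_ge assms by auto
qed

subsection \<open>Rotation invariance\<close>

lemma nn_integral_lborel_translate:
  fixes h :: "'a::euclidean_space \<Rightarrow> ennreal"
  assumes [measurable]: "h \<in> borel_measurable borel"
  shows "(\<integral>\<^sup>+x. h (x + c) \<partial>lborel) = (\<integral>\<^sup>+x. h x \<partial>lborel)"
proof -
  have "(\<integral>\<^sup>+x. h x \<partial>lborel) = (\<integral>\<^sup>+x. h x \<partial>distr lborel borel ((+) c))"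
    by (simp add: lborel_distr_plus)
  then show ?thesis by (simp add: nn_integral_distr add.commute)
qed

lemma nn_integral_lborel_reflect:
  fixes h :: "'a::euclidean_space \<Rightarrow> ennreal"
  assumes [measurable]: "h \<in> borel_measurable borel"
  shows "(\<integral>\<^sup>+x. h (c - x) \<partial>lborel) = (\<integral>\<^sup>+x. h x \<partial>lborel)"
  by (subst (2) lborel_affine[of "-1" c]) (auto simp: density_1 nn_integral_distr)

lemma borel_measurable_orthogonal_transformation:
  fixes T :: "'a::euclidean_space \<Rightarrow> 'a"
  shows "orthogonal_transformation T \<Longrightarrow> T \<in> borel_measurable borel"
  by (simp add: borel_measurable_continuous_onI linear_continuous_on linear_conv_bounded_linear[symmetric]
      orthogonal_transformation_linear)

text \<open>Integrating \<open>g (T x) * indicator B (y + T x)\<close> over \<open>x\<close> and \<open>y\<close> in both orders, for the unit ball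
  \<open>B\<close>, uses only translation invariance and \<open>T -` B = B\<close>; no determinant is needed.\<close>
lemma nn_integral_lborel_orthogonal_transformation:
  fixes T :: "'a::euclidean_space \<Rightarrow> 'a" and g :: "'a \<Rightarrow> ennreal"
  assumes T: "orthogonal_transformation T" and g[measurable]: "g \<in> borel_measurable borel"
  shows "(\<integral>\<^sup>+x. g (T x) \<partial>lborel) = (\<integral>\<^sup>+x. g x \<partial>lborel)"
proof -
  let ?B = "ball 0 1 :: 'a set"
  note [measurable] = borel_measurable_orthogonal_transformation[OF T]
  have [measurable]: "?B \<in> sets borel" by auto
  obtain T' where T': "\<And>y. T (T' y) = y"
    using orthogonal_transformation_surj[OF T] by (metis surjD)
  have shift: "(\<integral>\<^sup>+x. g (T x) * indicator ?B (y + T x) \<partial>lborel)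
      = (\<integral>\<^sup>+x. g (T x - y) * indicator ?B (T x) \<partial>lborel)" for y
    using nn_integral_lborel_translate[of "\<lambda>x. g (T x) * indicator ?B (y + T x)" "- T' y"]
    by (simp add: linear_diff[OF orthogonal_transformation_linear[OF T]] T')
  have "(\<integral>\<^sup>+x. g (T x) \<partial>lborel) * emeasure lborel ?B
      = (\<integral>\<^sup>+x. g (T x) * (\<integral>\<^sup>+y. indicator ?B (y + T x) \<partial>lborel) \<partial>lborel)"
    by (simp add: nn_integral_multc nn_integral_lborel_translate[of "indicator ?B"])
  also have "\<dots> = (\<integral>\<^sup>+x. \<integral>\<^sup>+y. g (T x) * indicator ?B (y + T x) \<partial>lborel \<partial>lborel)"
    by (simp add: nn_integral_cmult borel_measurable_indicator')
  also have "\<dots> = (\<integral>\<^sup>+y. \<integral>\<^sup>+x. g (T x) * indicator ?B (y + T x) \<partial>lborel \<partial>lborel)"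
    by (rule lborel_pair.Fubini') measurable
  also have "\<dots> = (\<integral>\<^sup>+x. \<integral>\<^sup>+y. g (T x - y) * indicator ?B (T x) \<partial>lborel \<partial>lborel)"
    unfolding shift by (rule lborel_pair.Fubini') measurable
  also have "\<dots> = (\<integral>\<^sup>+x. (\<integral>\<^sup>+y. g y \<partial>lborel) * indicator ?B x \<partial>lborel)"
    by (subst nn_integral_multc)
       (auto simp: nn_integral_lborel_reflect indicator_def orthogonal_transformation_norm[OF T]
          intro!: nn_integral_cong)
  also have "\<dots> = (\<integral>\<^sup>+x. g x \<partial>lborel) * emeasure lborel ?B"
    by (simp add: nn_integral_cmult)
  finally show ?thesis
    using emeasure_ball[of 1 "0::'a"]
    by (simp add: mult_right_ennreal_cancel not_less[symmetric])
qed

lemma distr_lborel_orthogonal_transformation: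
  fixes T :: "'a::euclidean_space \<Rightarrow> 'a"
  assumes T: "orthogonal_transformation T"
  shows "distr lborel borel T = lborel"
proof (rule measure_eqI)
  note [measurable] = borel_measurable_orthogonal_transformation[OF T]
  fix A assume "A \<in> sets (distr lborel borel T)"
  then have [measurable]: "A \<in> sets borel" by simp
  have "emeasure (distr lborel borel T) A = (\<integral>\<^sup>+x. indicator A x \<partial>distr lborel borel T)"
    by simp
  also have "\<dots> = (\<integral>\<^sup>+x. indicator A (T x) \<partial>lborel)"
    by (rule nn_integral_distr) measurable
  also have "\<dots> = emeasure lborel A"
    by (simp add: nn_integral_lborel_orthogonal_transformation[OF T])
  finally show "emeasure (distr lborel borel T) A = emeasure lborel A" .
qed simp

subsection \<open>Heights on the sphere\<close>

lemma nn_integral_greaterThan_eqI: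
  fixes M N :: "real measure" and g :: "real \<Rightarrow> ennreal"
  assumes sets[measurable_cong]: "sets M = sets borel" "sets N = sets borel"
    and fin: "emeasure M {a<..} < \<infinity>"
    and tails: "\<And>x. a \<le> x \<Longrightarrow> emeasure M {x<..} = emeasure N {x<..}"
    and [measurable]: "g \<in> borel_measurable borel"
  shows "(\<integral>\<^sup>+t. g t * indicator {a<..} t \<partial>M) = (\<integral>\<^sup>+t. g t * indicator {a<..} t \<partial>N)"
proof -
  have restricted: "emeasure (density L (indicator {a<..})) {x<..} = emeasure L {max a x<..}"
    if "sets L = sets borel" for L :: "real measure" and x
    using that by (simp add: emeasure_restricted) (rule arg_cong[where f = "emeasure L"], auto)
  have "density M (indicator {a<..}) = density N (indicator {a<..})"
  proof (rule measure_eqI_lessThan)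
    fix x
    have "emeasure M {max a x<..} \<le> emeasure M {a<..}"
      using sets by (intro emeasure_mono) auto
    then show "emeasure (density M (indicator {a<..})) {x<..} < \<infinity>"
      using fin sets by (simp add: restricted)
  qed (use sets tails in \<open>simp_all add: restricted\<close>)
  then have "(\<integral>\<^sup>+t. g t \<partial>density M (indicator {a<..})) = (\<integral>\<^sup>+t. g t \<partial>density N (indicator {a<..}))"
    by simp
  then show ?thesis
    by (simp add: nn_integral_density mult.commute)
qed

lemma emeasure_PiM_open_ball:
  assumes "finite A" and r: "r > 0"
  shows "emeasure (Pi\<^sub>M A (\<lambda>_. lborel)) {f \<in> space (Pi\<^sub>M A (\<lambda>_. lborel)). sqrt (\<Sum>i\<in>A. (f i)\<^sup>2) < r}
    = ennreal (unit_ball_vol (real (card A)) * r ^ card A)"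
    (is "emeasure ?M ?U = ennreal (?v r)")
proof (rule antisym)
  have closed: "emeasure ?M ({f. sqrt (\<Sum>i\<in>A. (f i)\<^sup>2) \<le> s} \<inter> space ?M) = ennreal (?v s)" if "s > 0" for s
    using emeasure_cball_aux[OF \<open>finite A\<close> that] .
  show "emeasure ?M ?U \<le> ennreal (?v r)"
    unfolding closed[OF r, symmetric] by (rule emeasure_mono) auto
  show "ennreal (?v r) \<le> emeasure ?M ?U"
  proof (rule tendsto_upperbound)
    show "((\<lambda>s. ennreal (?v s)) \<longlongrightarrow> ennreal (?v r)) (at_left r)"
      by (intro tendsto_ennrealI tendsto_intros)
    show "\<forall>\<^sub>F s in at_left r. ennreal (?v s) \<le> emeasure ?M ?U"
      using eventually_at_left_real[OF r]
    proof eventually_elim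
      fix s assume "s \<in> {0<..<r}"
      then show "ennreal (?v s) \<le> emeasure ?M ?U"
        by (subst closed[symmetric]) (auto intro!: emeasure_mono)
    qed
  qed simp
qed

text \<open>The density of the image of Lebesgue measure on \<open>\<real>\<^sup>N\<close> under \<open>y \<mapsto> 1 / sqrt (1 + \<bar>y\<bar>\<^sup>2)\<close>.\<close>
definition slope_density :: "nat \<Rightarrow> real \<Rightarrow> real" where
  "slope_density N t = real N * unit_ball_vol (real N) * (1 / t\<^sup>2 - 1) powr (real N / 2 - 1) / t ^ 3"

lemma borel_measurable_slope_density [measurable]: "slope_density N \<in> borel_measurable borel"
  unfolding slope_density_def[abs_def] by measurable

lemma nn_integral_slope_density_tail:
  assumes N: "N > 0" and \<tau>: "0 < \<tau>" "\<tau> \<le> 1"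
  shows "(\<integral>\<^sup>+t. ennreal (slope_density N t) * indicator {\<tau><..<1} t \<partial>lborel)
    = ennreal (unit_ball_vol (real N) * (1 / \<tau>\<^sup>2 - 1) powr (real N / 2))"
proof -
  let ?F = "\<lambda>t. - unit_ball_vol (real N) * (1 / t\<^sup>2 - 1) powr (real N / 2)"
  have "(slope_density N has_integral ?F 1 - ?F \<tau>) {\<tau>..1}"
  proof (rule fundamental_theorem_of_calculus_interior)
    show "continuous_on {\<tau>..1} ?F"
      using \<tau> N by (intro continuous_intros continuous_on_powr') (auto simp: power_le_one)
    fix t assume t: "t \<in> {\<tau><..<1}"
    have "1 / t\<^sup>2 - 1 > 0" using t \<tau> by (simp add: power_less_one_iff field_simps)
    then have "(?F has_real_derivative slope_density N t) (at t)"
      unfolding slope_density_def using t \<tau>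
      by (auto intro!: derivative_eq_intros simp: field_simps power2_eq_square power3_eq_cube)
    then show "(?F has_vector_derivative slope_density N t) (at t)"
      by (rule has_real_derivative_iff_has_vector_derivative[THEN iffD1])
  qed (use \<tau> in auto)
  then have "(slope_density N has_integral
      unit_ball_vol (real N) * (1 / \<tau>\<^sup>2 - 1) powr (real N / 2)) {\<tau><..<1}"
    by (simp add: has_integral_Icc_iff_Ioo)
  from nn_integral_has_integral_lebesgue'[OF _ this] \<tau> show ?thesis
    by (auto simp: slope_density_def)
qed

lemma slope_greater_iff:
  fixes a S x :: real
  assumes "0 < a" "0 \<le> S" "0 < x" "x < 1"
  shows "x < a / sqrt (a\<^sup>2 + S) \<longleftrightarrow> sqrt S < a * sqrt (1 / x\<^sup>2 - 1)"
proof -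
  have "0 < sqrt (a\<^sup>2 + S)" using assms by (simp add: add_pos_nonneg)
  then have "x < a / sqrt (a\<^sup>2 + S) \<longleftrightarrow> sqrt (a\<^sup>2 + S) < a / x"
    using assms by (simp add: pos_less_divide_eq mult.commute)
  also have "\<dots> \<longleftrightarrow> a\<^sup>2 + S < (a / x)\<^sup>2"
    using assms by (metis divide_pos_pos less_imp_le real_sqrt_less_iff real_sqrt_unique)
  also have "\<dots> \<longleftrightarrow> S < a\<^sup>2 * (1 / x\<^sup>2 - 1)"
    using assms by (simp add: power_divide algebra_simps)
  also have "\<dots> \<longleftrightarrow> sqrt S < sqrt (a\<^sup>2 * (1 / x\<^sup>2 - 1))"
    by (rule real_sqrt_less_iff[symmetric])
  also have "sqrt (a\<^sup>2 * (1 / x\<^sup>2 - 1)) = a * sqrt (1 / x\<^sup>2 - 1)"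
    using assms by (simp add: real_sqrt_mult)
  finally show ?thesis .
qed

lemma emeasure_PiM_slope_greater:
  assumes A: "finite A" "A \<noteq> {}" and a: "a > 0" and x: "x > 0"
  shows "emeasure (Pi\<^sub>M A (\<lambda>_. lborel)) {f \<in> space (Pi\<^sub>M A (\<lambda>_. lborel)).
        x < a / sqrt (a\<^sup>2 + (\<Sum>i\<in>A. (f i)\<^sup>2))}
    = ennreal (a ^ card A) * (\<integral>\<^sup>+t. ennreal (slope_density (card A) t) * indicator {x<..<1} t \<partial>lborel)"
proof (cases "x < 1")
  case True
  have N: "card A > 0" using A by (auto simp: card_gt_0_iff)
  have y: "1 / x\<^sup>2 - 1 > 0" using x True by (simp add: power_less_one_iff)
  then have "(1 / x\<^sup>2 - 1) powr (real (card A) / 2) = sqrt (1 / x\<^sup>2 - 1) ^ card A"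
    by (subst powr_realpow[symmetric]) (auto simp: powr_half_sqrt[symmetric] powr_powr)
  then show ?thesis
    using A N a x True y emeasure_PiM_open_ball[of A "a * sqrt (1 / x\<^sup>2 - 1)"]
    by (simp add: slope_greater_iff sum_nonneg nn_integral_slope_density_tail power_mult_distrib
        ennreal_mult'[symmetric] mult_ac)
next
  case False
  have "a / sqrt (a\<^sup>2 + (\<Sum>i\<in>A. (f i)\<^sup>2)) \<le> x" for f
  proof -
    have "a \<le> sqrt (a\<^sup>2 + (\<Sum>i\<in>A. (f i)\<^sup>2))" by (simp add: real_le_rsqrt sum_nonneg)
    then have "a / sqrt (a\<^sup>2 + (\<Sum>i\<in>A. (f i)\<^sup>2)) \<le> 1" using a by (subst divide_le_eq_1_pos) linarith+
    then show ?thesis using False by linarith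
  qed
  then show ?thesis using False by (simp add: not_less[symmetric])
qed

lemma nn_integral_PiM_slope:
  fixes g :: "real \<Rightarrow> ennreal" and a :: real
  assumes g[measurable]: "g \<in> borel_measurable borel" and A: "finite A" "A \<noteq> {}" and a: "a > 0"
  defines "slope f \<equiv> a / sqrt (a\<^sup>2 + (\<Sum>i\<in>A. (f i)\<^sup>2))"
  shows "(\<integral>\<^sup>+f. g (slope f) * indicator {a<..} (slope f) \<partial>Pi\<^sub>M A (\<lambda>_. lborel)) =
    (\<integral>\<^sup>+t. g t * (ennreal (a ^ card A) * ennreal (slope_density (card A) t) * indicator {a<..<1} t) \<partial>lborel)"
proof -
  let ?P = "Pi\<^sub>M A (\<lambda>_. lborel) :: ('a \<Rightarrow> real) measure"
  define q where "q t = ennreal (slope_density (card A) t)" for t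
  define L where "L = density lborel (\<lambda>t. ennreal (a ^ card A) * (q t * indicator {0<..<1} t))"
  have N: "card A > 0" using A by (auto simp: card_gt_0_iff)
  have [measurable]: "slope \<in> borel_measurable ?P" unfolding slope_def[abs_def] by measurable
  have [measurable]: "q \<in> borel_measurable borel" unfolding q_def[abs_def] by measurable
  have sets_L [measurable_cong]: "sets L = sets borel" by (simp add: L_def)
  have L_tail: "emeasure L {x<..} = ennreal (a ^ card A) * (\<integral>\<^sup>+t. q t * indicator {x<..<1} t \<partial>lborel)"
    if "a \<le> x" for x
  proof -
    have "emeasure L {x<..} = (\<integral>\<^sup>+t. ennreal (a ^ card A) * (q t * indicator {x<..<1} t) \<partial>lborel)"
      unfolding L_def using a that
      by (subst emeasure_density) (auto intro!: nn_integral_cong simp: indicator_def)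
    then show ?thesis by (simp add: nn_integral_cmult)
  qed
  have slope_tail: "emeasure (distr ?P borel slope) {x<..} = emeasure L {x<..}" if "a \<le> x" for x
  proof -
    have "emeasure (distr ?P borel slope) {x<..} = emeasure ?P {f \<in> space ?P. x < slope f}"
      by (subst emeasure_distr) (auto intro!: arg_cong[where f = "emeasure ?P"])
    then show ?thesis
      using emeasure_PiM_slope_greater[OF A a, of x] a that by (simp add: L_tail q_def slope_def)
  qed
  have "emeasure L {a<..} < \<infinity>"
    using N nn_integral_slope_density_tail[of "card A" a] a
    by (cases "a \<le> 1") (simp_all add: L_tail q_def ennreal_mult_less_top)
  then have "(\<integral>\<^sup>+t. g t * indicator {a<..} t \<partial>distr ?P borel slope) = (\<integral>\<^sup>+t. g t * indicator {a<..} t \<partial>L)"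
    by (intro nn_integral_greaterThan_eqI) (use sets_L in \<open>simp_all add: slope_tail\<close>)
  also have "\<dots> = (\<integral>\<^sup>+t. g t * (ennreal (a ^ card A) * q t * indicator {a<..<1} t) \<partial>lborel)"
    unfolding L_def using a by (subst nn_integral_density)
      (auto intro!: nn_integral_cong simp: indicator_def mult.commute)
  finally show ?thesis by (simp add: q_def nn_integral_distr)
qed

lemma nn_integral_lborel_inner_norm:
  fixes h :: "real \<times> real \<Rightarrow> ennreal" and b :: "'a::euclidean_space"
  assumes [measurable]: "h \<in> borel_measurable (borel \<Otimes>\<^sub>M borel)" and b: "b \<in> Basis"
  shows "(\<integral>\<^sup>+x. h (x \<bullet> b, norm x) \<partial>lborel) =
    (\<integral>\<^sup>+a. \<integral>\<^sup>+f. h (a, sqrt (a\<^sup>2 + (\<Sum>i\<in>Basis - {b}. (f i)\<^sup>2))) \<partial>Pi\<^sub>M (Basis - {b}) (\<lambda>_. lborel) \<partial>lborel)"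
proof -
  interpret product_sigma_finite "\<lambda>_::'a. lborel :: real measure" by standard
  have basis: "insert b (Basis - {b}) = Basis" using b by auto
  have coordinates: "h ((\<Sum>i\<in>Basis. f i *\<^sub>R i) \<bullet> b, norm (\<Sum>i\<in>Basis. f i *\<^sub>R i))
      = h (f b, sqrt ((f b)\<^sup>2 + (\<Sum>i\<in>Basis - {b}. (f i)\<^sup>2)))" for f
  proof -
    define x where "x = (\<Sum>i\<in>Basis. f i *\<^sub>R i)"
    have x: "x \<bullet> i = f i" if "i \<in> Basis" for i using that by (simp add: x_def)
    have "norm x = sqrt (\<Sum>i\<in>Basis. (f i)\<^sup>2)"
      by (simp add: norm_eq_sqrt_inner euclidean_inner[of x x] power2_eq_square x)
    also have "(\<Sum>i\<in>Basis. (f i)\<^sup>2) = (f b)\<^sup>2 + (\<Sum>i\<in>Basis - {b}. (f i)\<^sup>2)"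
      using b by (simp add: sum.remove)
    finally show ?thesis using x[OF b] by (simp add: x_def)
  qed
  have "(\<integral>\<^sup>+x. h (x \<bullet> b, norm x) \<partial>lborel)
      = (\<integral>\<^sup>+f. h (f b, sqrt ((f b)\<^sup>2 + (\<Sum>i\<in>Basis - {b}. (f i)\<^sup>2))) \<partial>Pi\<^sub>M Basis (\<lambda>_. lborel))"
    by (subst lborel_eq) (simp add: nn_integral_distr coordinates)
  also have "\<dots> = (\<integral>\<^sup>+f. h (f b, sqrt ((f b)\<^sup>2 + (\<Sum>i\<in>Basis - {b}. (f i)\<^sup>2)))
      \<partial>Pi\<^sub>M (insert b (Basis - {b})) (\<lambda>_. lborel))"
    unfolding basis ..
  also have "\<dots> = (\<integral>\<^sup>+a. \<integral>\<^sup>+f. h (a, sqrt (a\<^sup>2 + (\<Sum>i\<in>Basis - {b}. (f i)\<^sup>2)))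
      \<partial>Pi\<^sub>M (Basis - {b}) (\<lambda>_. lborel) \<partial>lborel)"
    by (subst product_nn_integral_insert_rev) (auto intro!: nn_integral_cong arg_cong[where f = h] sum.cong)
  finally show ?thesis .
qed

lemma nn_integral_abs_power_interval:
  fixes t :: real
  assumes "t > 0"
  shows "(\<integral>\<^sup>+a. ennreal (\<bar>a\<bar> ^ N) * indicator {-t<..<t} a \<partial>lborel) = ennreal (2 * t ^ Suc N / real (Suc N))"
proof -
  have "((\<lambda>a. a ^ N) has_integral (t ^ Suc N / real (Suc N) - 0 ^ Suc N / real (Suc N))) {0..t}"
    by (rule fundamental_theorem_of_calculus)
       (use assms in \<open>auto intro!: derivative_eq_intros
          simp: has_real_derivative_iff_has_vector_derivative[symmetric] simp del: of_nat_Suc power_Suc\<close>)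
  then have integral: "((\<lambda>a. a ^ N) has_integral t ^ Suc N / real (Suc N)) {0<..<t}"
    by (simp add: has_integral_Icc_iff_Ioo)
  have "(\<integral>\<^sup>+a. ennreal (\<bar>a\<bar> ^ N) * indicator {0<..<t} a \<partial>lborel)
      = (\<integral>\<^sup>+a. ennreal (a ^ N) * indicator {0<..<t} a \<partial>lborel)"
    by (rule nn_integral_cong) (auto simp: indicator_def)
  also have "\<dots> = ennreal (t ^ Suc N / real (Suc N))"
    by (rule nn_integral_has_integral_lebesgue'[OF _ integral]) auto
  finally have right: "(\<integral>\<^sup>+a. ennreal (\<bar>a\<bar> ^ N) * indicator {0<..<t} a \<partial>lborel)
      = ennreal (t ^ Suc N / real (Suc N))" .
  have left: "(\<integral>\<^sup>+a. ennreal (\<bar>a\<bar> ^ N) * indicator {-t<..<0} a \<partial>lborel)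
      = (\<integral>\<^sup>+a. ennreal (\<bar>a\<bar> ^ N) * indicator {0<..<t} a \<partial>lborel)"
    by (subst nn_integral_real_affine[where c = "-1" and t = 0])
       (auto simp: indicator_def intro!: nn_integral_cong)
  have "AE a::real in lborel. a \<noteq> 0" by (rule AE_lborel_singleton)
  then have "(\<integral>\<^sup>+a. ennreal (\<bar>a\<bar> ^ N) * indicator {-t<..<t} a \<partial>lborel) =
    (\<integral>\<^sup>+a. ennreal (\<bar>a\<bar> ^ N) * indicator {-t<..<0} a + ennreal (\<bar>a\<bar> ^ N) * indicator {0<..<t} a \<partial>lborel)"
    by (intro nn_integral_cong_AE, elim eventually_mono) (use assms in \<open>auto simp: indicator_def\<close>)
  also have "\<dots> = ennreal (t ^ Suc N / real (Suc N)) + ennreal (t ^ Suc N / real (Suc N))"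
    by (subst nn_integral_add) (auto simp: left right)
  also have "\<dots> = ennreal (2 * t ^ Suc N / real (Suc N))"
    using assms by (subst ennreal_plus[symmetric]) (auto simp del: ennreal_plus)
  finally show ?thesis .
qed

lemma nn_integral_double_cone:
  fixes g :: "real \<Rightarrow> ennreal"
  assumes [measurable]: "g \<in> borel_measurable borel"
  shows "(\<integral>\<^sup>+a. \<integral>\<^sup>+t. ennreal (\<bar>a\<bar> ^ N) * (g t * indicator {\<bar>a\<bar><..} t) \<partial>lborel \<partial>lborel) =
    (\<integral>\<^sup>+t. g t * (ennreal (2 * t ^ Suc N / real (Suc N)) * indicator {0<..} t) \<partial>lborel)"
proof -
  have [measurable]: "Measurable.pred (lborel \<Otimes>\<^sub>M lborel) (\<lambda>(t::real, a). a \<in> {-t<..<t})"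
    unfolding greaterThanLessThan_iff by measurable
  have "(\<integral>\<^sup>+a. \<integral>\<^sup>+t. ennreal (\<bar>a\<bar> ^ N) * (g t * indicator {\<bar>a\<bar><..} t) \<partial>lborel \<partial>lborel) =
    (\<integral>\<^sup>+a. \<integral>\<^sup>+t. g t * (ennreal (\<bar>a\<bar> ^ N) * indicator {-t<..<t} a) \<partial>lborel \<partial>lborel)"
    by (intro nn_integral_cong) (auto simp: indicator_def mult.commute)
  also have "\<dots> = (\<integral>\<^sup>+t. \<integral>\<^sup>+a. g t * (ennreal (\<bar>a\<bar> ^ N) * indicator {-t<..<t} a) \<partial>lborel \<partial>lborel)"
    by (rule lborel_pair.Fubini') (simp add: indicator_def, measurable)
  also have "\<dots> = (\<integral>\<^sup>+t. g t * (ennreal (2 * t ^ Suc N / real (Suc N)) * indicator {0<..} t) \<partial>lborel)"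
  proof (rule nn_integral_cong)
    fix t :: real
    show "(\<integral>\<^sup>+a. g t * (ennreal (\<bar>a\<bar> ^ N) * indicator {-t<..<t} a) \<partial>lborel)
        = g t * (ennreal (2 * t ^ Suc N / real (Suc N)) * indicator {0<..} t)"
    proof (cases "t > 0")
      case True
      then show ?thesis by (simp add: nn_integral_cmult nn_integral_abs_power_interval)
    qed simp
  qed
  finally show ?thesis .
qed

text \<open>Twice the surface area of the equator \<open>S\<^sup>N\<^sup>-\<^sup>1\<close> of \<open>S\<^sup>N\<close>, once for each hemisphere.\<close>
definition height_const :: "nat \<Rightarrow> real" where
  "height_const N = 2 * real N * unit_ball_vol (real N)"

lemma height_const_pos: "N > 0 \<Longrightarrow> height_const N > 0"
  by (simp add: height_const_def)

lemma slope_density_times_power: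
  fixes t :: real
  assumes t: "0 < t" "t < 1"
  shows "slope_density N t * (2 * t ^ Suc N / real (Suc N))
    = height_const N / real (Suc N) * (1 - t\<^sup>2) powr (real N / 2 - 1)"
proof -
  have "1 / t\<^sup>2 - 1 = (1 - t\<^sup>2) * t powr (-2)" using t by (simp add: powr_minus field_simps)
  then have "(1 / t\<^sup>2 - 1) powr (real N / 2 - 1)
      = (1 - t\<^sup>2) powr (real N / 2 - 1) * (t powr (-2)) powr (real N / 2 - 1)"
    using t one_minus_square_pos[OF t] by (simp only: powr_mult)
  also have "(t powr (-2)) powr (real N / 2 - 1) = t powr (2 - real N)"
    unfolding powr_powr by (rule arg_cong[where f = "(powr) t"]) simp
  finally have "(1 / t\<^sup>2 - 1) powr (real N / 2 - 1)
      = (1 - t\<^sup>2) powr (real N / 2 - 1) * t powr (2 - real N)" .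
  moreover have "t powr (2 - real N) * t ^ Suc N / t ^ 3 = 1"
    using t by (simp add: powr_diff powr_realpow field_simps power2_eq_square power3_eq_cube)
  ultimately have "slope_density N t * t ^ Suc N = height_const N / 2 * (1 - t\<^sup>2) powr (real N / 2 - 1)"
    by (simp add: slope_density_def height_const_def field_simps)
  then show ?thesis by (simp only: times_divide_eq_right) (simp add: mult.left_commute)
qed

lemma nn_integral_sphere_measure:
  fixes G :: "'a::euclidean_space \<Rightarrow> ennreal"
  assumes [measurable]: "G \<in> borel_measurable borel"
  shows "(\<integral>\<^sup>+x. G x \<partial>sphere_measure) =
    of_nat DIM('a) * (\<integral>\<^sup>+x. G (x /\<^sub>R norm x) * indicator (ball 0 1 - {0}) x \<partial>lborel)"
proof -
  have [measurable]: "(\<lambda>x::'a. x /\<^sub>R norm x) \<in> borel_measurable (restrict_space lborel (ball 0 1 - {0}))"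
    by (rule measurable_restrict_space1) measurable
  show ?thesis
    unfolding sphere_measure_def
    by (simp add: nn_integral_scale_measure nn_integral_distr nn_integral_restrict_space)
qed

lemma sets_sphere_measure [measurable_cong, simp]: "sets sphere_measure = sets borel"
  by (simp add: sphere_measure_def)

lemma space_sphere_measure [simp]: "space sphere_measure = UNIV"
  by (simp add: sphere_measure_def space_scale_measure)

lemma AE_sphere_measure_norm_eq_1:
  "AE x in (sphere_measure :: 'a::euclidean_space measure). norm x = 1"
proof (rule AE_I')
  let ?B = "{x :: 'a. norm x \<noteq> 1}"
  have [measurable]: "?B \<in> sets borel" by measurable
  have outside: "indicator ?B (x /\<^sub>R norm x) * indicator (ball 0 1 - {0}) x = (0 :: ennreal)" for x
    by (auto simp: indicator_def)
  have "emeasure sphere_measure ?B = (\<integral>\<^sup>+x. indicator ?B x \<partial>(sphere_measure :: 'a measure))"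
    by simp
  also have "\<dots> = 0"
    by (subst nn_integral_sphere_measure) (measurable, unfold outside, simp)
  finally show "?B \<in> null_sets sphere_measure" by (simp add: null_sets_def)
qed auto

lemma nn_integral_PiM_ball_slice:
  fixes g :: "real \<Rightarrow> ennreal"
  assumes "g \<in> borel_measurable borel" and A: "finite A" "A \<noteq> {}" and a: "a \<noteq> 0"
  defines "r f \<equiv> sqrt (a\<^sup>2 + (\<Sum>i\<in>A. (f i)\<^sup>2))"
  shows "(\<integral>\<^sup>+f. g (\<bar>a\<bar> / r f) * indicator {0<..<1} (r f) \<partial>Pi\<^sub>M A (\<lambda>_. lborel)) =
    (\<integral>\<^sup>+t. ennreal (\<bar>a\<bar> ^ card A) *
       (g t * ennreal (slope_density (card A) t) * indicator {..<1} t * indicator {\<bar>a\<bar><..} t) \<partial>lborel)"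
proof -
  have "0 < r f" for f using a by (simp add: r_def add_pos_nonneg sum_nonneg)
  then have "r f \<in> {0<..<1} \<longleftrightarrow> \<bar>a\<bar> / r f \<in> {\<bar>a\<bar><..}" for f
    using a by (simp add: pos_less_divide_eq)
  then have "(\<integral>\<^sup>+f. g (\<bar>a\<bar> / r f) * indicator {0<..<1} (r f) \<partial>Pi\<^sub>M A (\<lambda>_. lborel))
    = (\<integral>\<^sup>+f. g (\<bar>a\<bar> / r f) * indicator {\<bar>a\<bar><..} (\<bar>a\<bar> / r f) \<partial>Pi\<^sub>M A (\<lambda>_. lborel))"
    by (simp add: indicator_def)
  also have "\<dots> = (\<integral>\<^sup>+t. g t * (ennreal (\<bar>a\<bar> ^ card A) * ennreal (slope_density (card A) t) *
      indicator {\<bar>a\<bar><..<1} t) \<partial>lborel)"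
    using nn_integral_PiM_slope[OF assms(1) A, of "\<bar>a\<bar>"] a by (simp add: r_def)
  finally show ?thesis
    by (auto simp: indicator_def mult_ac intro!: nn_integral_cong elim!: trans)
qed

text \<open>The ball is cut into slices \<open>x \<bullet> b = a\<close>, on which the height \<open>\<bar>a\<bar> / norm x\<close> has a known
  distribution; exchanging the integrals over \<open>a\<close> and the height leaves a power of \<open>\<bar>a\<bar>\<close>.\<close>
lemma nn_integral_sphere_measure_inner_Basis:
  fixes g :: "real \<Rightarrow> ennreal" and b :: "'a::euclidean_space"
  assumes g[measurable]: "g \<in> borel_measurable borel" and b: "b \<in> Basis" and d: "DIM('a) \<ge> 2"
  shows "(\<integral>\<^sup>+x. g \<bar>x \<bullet> b\<bar> \<partial>sphere_measure) =
    ennreal (height_const (DIM('a) - 1)) * (\<integral>\<^sup>+t. g t \<partial>height_measure (real (DIM('a) - 1)) 0)"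
proof -
  define A :: "'a set" where "A = Basis - {b}"
  define N where "N = DIM('a) - 1"
  define r where "r a f = sqrt (a\<^sup>2 + (\<Sum>i\<in>A. (f i)\<^sup>2))" for a and f :: "'a \<Rightarrow> real"
  have A: "finite A" "A \<noteq> {}" "card A = N" and N: "N > 0" "DIM('a) = Suc N"
    using b d card_gt_0_iff[of A] by (auto simp: A_def N_def)
  have "(\<integral>\<^sup>+x. g \<bar>x \<bullet> b\<bar> \<partial>sphere_measure) =
      of_nat (Suc N) * (\<integral>\<^sup>+x. g (\<bar>x \<bullet> b\<bar> / norm x) * indicator {0<..<1} (norm x) \<partial>(lborel :: 'a measure))"
    by (subst nn_integral_sphere_measure)
       (auto simp: N(2) divide_inverse mult.commute abs_mult indicator_def
          intro!: nn_integral_cong arg_cong2[where f = "(*)"])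
  also have "(\<integral>\<^sup>+x. g (\<bar>x \<bullet> b\<bar> / norm x) * indicator {0<..<1} (norm x) \<partial>(lborel :: 'a measure)) =
    (\<integral>\<^sup>+a. \<integral>\<^sup>+f. g (\<bar>a\<bar> / r a f) * indicator {0<..<1} (r a f) \<partial>Pi\<^sub>M A (\<lambda>_. lborel) \<partial>lborel)"
    using nn_integral_lborel_inner_norm[of "\<lambda>(a, r). g (\<bar>a\<bar> / r) * indicator {0<..<1} r", OF _ b]
    by (simp add: A_def r_def)
  also have "\<dots> = (\<integral>\<^sup>+a. \<integral>\<^sup>+t. ennreal (\<bar>a\<bar> ^ N) *
      (g t * ennreal (slope_density N t) * indicator {..<1} t * indicator {\<bar>a\<bar><..} t) \<partial>lborel \<partial>lborel)"
    using AE_lborel_singleton[of 0]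
    by (intro nn_integral_cong_AE) (auto elim!: eventually_mono simp: r_def nn_integral_PiM_ball_slice A)
  also have "\<dots> = (\<integral>\<^sup>+t. g t * ennreal (slope_density N t) * indicator {..<1} t *
      (ennreal (2 * t ^ Suc N / real (Suc N)) * indicator {0<..} t) \<partial>lborel)"
    by (rule nn_integral_double_cone) measurable
  also have "\<dots> = (\<integral>\<^sup>+t. ennreal (height_const N / real (Suc N)) *
      (g t * (ennreal ((1 - t\<^sup>2) powr (real N / 2 - 1) * t powr 0) * indicator {0<..<1} t)) \<partial>lborel)"
  proof (rule nn_integral_cong)
    fix t :: real
    have "ennreal (slope_density N t) * ennreal (2 * t ^ Suc N / real (Suc N))
        = ennreal (height_const N / real (Suc N)) * ennreal ((1 - t\<^sup>2) powr (real N / 2 - 1) * t powr 0)"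
      if t: "0 < t" "t < 1"
      using slope_density_times_power[OF t, of N] t
      by (simp add: ennreal_mult''[symmetric] del: power_Suc of_nat_Suc)
    then show "g t * ennreal (slope_density N t) * indicator {..<1} t *
        (ennreal (2 * t ^ Suc N / real (Suc N)) * indicator {0<..} t)
      = ennreal (height_const N / real (Suc N)) *
          (g t * (ennreal ((1 - t\<^sup>2) powr (real N / 2 - 1) * t powr 0) * indicator {0<..<1} t))"
      by (auto simp: indicator_def mult_ac simp del: power_Suc of_nat_Suc)
  qed
  also have "\<dots> = ennreal (height_const N / real (Suc N)) * (\<integral>\<^sup>+t. g t \<partial>height_measure (real N) 0)"
    by (simp add: nn_integral_cmult nn_integral_height_measure)
  also have "of_nat (Suc N) * \<dots> = ennreal (height_const N) * (\<integral>\<^sup>+t. g t \<partial>height_measure (real N) 0)"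
    by (simp add: ennreal_of_nat_eq_real_of_nat ennreal_mult'[symmetric] mult.assoc[symmetric] del: of_nat_Suc)
  finally show ?thesis by (simp add: N_def)
qed

lemma nn_integral_sphere_measure_orthogonal_transformation:
  fixes T :: "'a::euclidean_space \<Rightarrow> 'a" and G :: "'a \<Rightarrow> ennreal"
  assumes T: "orthogonal_transformation T" and G[measurable]: "G \<in> borel_measurable borel"
  shows "(\<integral>\<^sup>+x. G (T x) \<partial>sphere_measure) = (\<integral>\<^sup>+x. G x \<partial>sphere_measure)"
proof -
  note [measurable] = borel_measurable_orthogonal_transformation[OF T]
  have [measurable]: "ball 0 1 - {0} \<in> sets (borel :: 'a measure)" by auto
  have T_eq_0: "T x = 0 \<longleftrightarrow> x = 0" for x
    using orthogonal_transformation_norm[OF T, of x] by (metis norm_eq_zero)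
  have "G (T (x /\<^sub>R norm x)) * indicator (ball 0 1 - {0}) x
      = G (T x /\<^sub>R norm (T x)) * indicator (ball 0 1 - {0}) (T x)" for x
    by (simp add: linear_scale[OF orthogonal_transformation_linear[OF T]] orthogonal_transformation_norm[OF T]
        indicator_def T_eq_0)
  then show ?thesis
    using nn_integral_lborel_orthogonal_transformation[OF T,
        of "\<lambda>x. G (x /\<^sub>R norm x) * indicator (ball 0 1 - {0}) x"]
    by (simp add: nn_integral_sphere_measure)
qed

lemma nn_integral_sphere_measure_inner:
  fixes g :: "real \<Rightarrow> ennreal" and v :: "real^'k"
  assumes g[measurable]: "g \<in> borel_measurable borel" and d: "CARD('k::finite) \<ge> 2"
  shows "(\<integral>\<^sup>+x. g \<bar>x \<bullet> v\<bar> \<partial>sphere_measure) =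
    ennreal (height_const (CARD('k) - 1)) * (\<integral>\<^sup>+t. g (norm v * t) \<partial>height_measure (real (CARD('k) - 1)) 0)"
proof -
  define b where "b = (axis undefined 1 :: real^'k)"
  have b: "b \<in> Basis" by (simp add: b_def)
  then have "norm (norm v *\<^sub>R b) = norm v" by simp
  then obtain T where T: "orthogonal_transformation T" "T (norm v *\<^sub>R b) = v"
    using orthogonal_transformation_exists by metis
  have "T x \<bullet> T (norm v *\<^sub>R b) = x \<bullet> (norm v *\<^sub>R b)" for x
    using T(1) unfolding orthogonal_transformation_def by blast
  then have "T x \<bullet> v = norm v * (x \<bullet> b)" for x
    by (simp add: T(2))
  then have "(\<integral>\<^sup>+x. g \<bar>x \<bullet> v\<bar> \<partial>sphere_measure) = (\<integral>\<^sup>+x. g (norm v * \<bar>x \<bullet> b\<bar>) \<partial>sphere_measure)"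
    using nn_integral_sphere_measure_orthogonal_transformation[OF T(1), of "\<lambda>x. g \<bar>x \<bullet> v\<bar>"]
    by (simp add: abs_mult)
  also have "\<dots> = ennreal (height_const (CARD('k) - 1)) *
      (\<integral>\<^sup>+t. g (norm v * t) \<partial>height_measure (real (CARD('k) - 1)) 0)"
    using nn_integral_sphere_measure_inner_Basis[OF _ b, of "\<lambda>t. g (norm v * t)"] d by simp
  finally show ?thesis .
qed

lemma distr_sphere_measure_inner:
  fixes v :: "real^'k"
  assumes "CARD('k::finite) \<ge> 2"
  shows "distr sphere_measure borel (\<lambda>x. \<bar>x \<bullet> v\<bar>) =
    density (distr (height_measure (real (CARD('k) - 1)) 0) borel (\<lambda>t. norm v * t))
      (\<lambda>_. ennreal (height_const (CARD('k) - 1)))"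
    (is "?L = ?R")
proof (rule measure_eqI)
  fix A assume "A \<in> sets ?L"
  then have [measurable]: "A \<in> sets borel" by simp
  have "emeasure ?L A = (\<integral>\<^sup>+t. indicator A t \<partial>?L)" by simp
  also have "\<dots> = (\<integral>\<^sup>+x. indicator A \<bar>x \<bullet> v\<bar> \<partial>sphere_measure)"
    by (rule nn_integral_distr) measurable
  also have "\<dots> = ennreal (height_const (CARD('k) - 1)) *
      (\<integral>\<^sup>+t. indicator A (norm v * t) \<partial>height_measure (real (CARD('k) - 1)) 0)"
    using assms by (rule nn_integral_sphere_measure_inner[rotated]) measurable
  also have "(\<integral>\<^sup>+t. indicator A (norm v * t) \<partial>height_measure (real (CARD('k) - 1)) 0)
      = (\<integral>\<^sup>+t. indicator A t \<partial>distr (height_measure (real (CARD('k) - 1)) 0) borel (\<lambda>t. norm v * t))"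
    by (rule nn_integral_distr[symmetric]) measurable
  also have "ennreal (height_const (CARD('k) - 1)) * \<dots> = emeasure ?R A"
    by (simp add: emeasure_density_const)
  finally show "emeasure ?L A = emeasure ?R A" .
qed simp

lemma
  fixes v :: "real^'k" and F :: "real \<Rightarrow> real"
  assumes F[measurable]: "F \<in> borel_measurable borel" and d: "CARD('k::finite) \<ge> 2"
  shows integrable_sphere_measure_inner_iff: "integrable sphere_measure (\<lambda>x. F \<bar>x \<bullet> v\<bar>) \<longleftrightarrow>
      integrable (height_measure (real (CARD('k) - 1)) 0) (\<lambda>t. F (norm v * t))"
    and integral_sphere_measure_inner: "(\<integral>x. F \<bar>x \<bullet> v\<bar> \<partial>sphere_measure) =
      height_const (CARD('k) - 1) * (\<integral>t. F (norm v * t) \<partial>height_measure (real (CARD('k) - 1)) 0)"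
proof -
  have pos: "height_const (CARD('k) - 1) > 0" using d by (intro height_const_pos) auto
  show "integrable sphere_measure (\<lambda>x. F \<bar>x \<bullet> v\<bar>) \<longleftrightarrow>
      integrable (height_measure (real (CARD('k) - 1)) 0) (\<lambda>t. F (norm v * t))"
    using pos d integrable_distr_eq[of "\<lambda>x. \<bar>x \<bullet> v\<bar>" sphere_measure borel F]
    by (simp add: distr_sphere_measure_inner integrable_density integrable_distr_eq)
  show "(\<integral>x. F \<bar>x \<bullet> v\<bar> \<partial>sphere_measure) =
      height_const (CARD('k) - 1) * (\<integral>t. F (norm v * t) \<partial>height_measure (real (CARD('k) - 1)) 0)"
    using pos d integral_distr[of "\<lambda>x. \<bar>x \<bullet> v\<bar>" sphere_measure borel F]
    by (simp add: distr_sphere_measure_inner integral_density integral_distr)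
qed

lemma borel_measurable_arccos [measurable]: "arccos \<in> borel_measurable borel"
proof -
  have "(\<lambda>x. if x \<in> {-1..1} then arccos x else arccos 2) \<in> borel_measurable borel"
    by (rule borel_measurable_continuous_on_if) (auto intro!: continuous_on_arccos' continuous_intros)
  moreover have "(if x \<in> {-1..1} then arccos x else arccos 2) = arccos x" for x
  proof (cases "x \<in> {-1..1}")
    case False
    then have "cos t \<noteq> x" for t using cos_ge_minus_one[of t] cos_le_one[of t] by auto
    moreover have "cos t \<noteq> 2" for t :: real using cos_le_one[of t] by linarith
    ultimately show ?thesis using False by (simp add: arccos_def)
  qed simp
  ultimately show ?thesis by simp
qed

lemma emeasure_weighted_sphere:
  fixes e :: "'a::euclidean_space"
  assumes E[measurable]: "E \<in> sets borel" and e: "e \<in> Basis" and n: "DIM('a) = n + 1" "n \<ge> 1"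
  shows "emeasure (weighted_sphere e a1 a2) {x. \<bar>x \<bullet> e\<bar> \<in> E} =
    ennreal (height_const n) * emeasure (height_measure (a1 + real n) a2) E"
proof -
  define w where "w t = sqrt (1 - t\<^sup>2) powr a1 * t powr a2" for t :: real
  have [measurable]: "w \<in> borel_measurable borel" unfolding w_def[abs_def] by measurable
  have weight: "sin (sph_dist e x) powr a1 * \<bar>cos (sph_dist e x)\<bar> powr a2 = w \<bar>x \<bullet> e\<bar>" if "norm x = 1" for x
  proof -
    have "\<bar>x \<bullet> e\<bar> \<le> 1" using Cauchy_Schwarz_ineq2[of x e] that e by simp
    then show ?thesis by (simp add: w_def sph_dist_def sin_arccos_abs inner_commute abs_le_iff)
  qed
  have density: "w t * (1 - t\<^sup>2) powr (real n / 2 - 1) = (1 - t\<^sup>2) powr ((a1 + real n) / 2 - 1) * t powr a2"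
    if "0 < t" "t < 1" for t
  proof -
    have "sqrt (1 - t\<^sup>2) powr a1 * (1 - t\<^sup>2) powr (real n / 2 - 1)
        = (1 - t\<^sup>2) powr (a1 / 2 + (real n / 2 - 1))"
      unfolding powr_add using one_minus_square_pos[OF that]
      by (simp add: powr_half_sqrt[symmetric] powr_powr)
    also have "a1 / 2 + (real n / 2 - 1) = (a1 + real n) / 2 - 1" by (simp add: field_simps)
    finally show ?thesis by (simp add: w_def mult_ac)
  qed
  have [measurable]: "{x. \<bar>x \<bullet> e\<bar> \<in> E} \<in> sets borel" by measurable
  have "emeasure (weighted_sphere e a1 a2) {x. \<bar>x \<bullet> e\<bar> \<in> E} =
      (\<integral>\<^sup>+x. ennreal (sin (sph_dist e x) powr a1 * \<bar>cos (sph_dist e x)\<bar> powr a2) *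
        indicator {x. \<bar>x \<bullet> e\<bar> \<in> E} x \<partial>sphere_measure)"
    unfolding weighted_sphere_def sph_dist_def by (subst emeasure_density) auto
  also have "\<dots> = (\<integral>\<^sup>+x. ennreal (w \<bar>x \<bullet> e\<bar>) * indicator E \<bar>x \<bullet> e\<bar> \<partial>sphere_measure)"
    using AE_sphere_measure_norm_eq_1
    by (intro nn_integral_cong_AE) (auto elim!: eventually_mono simp: weight indicator_def)
  also have "\<dots> = ennreal (height_const n) * (\<integral>\<^sup>+t. ennreal (w t) *
      indicator E t \<partial>height_measure (real n) 0)"
    using nn_integral_sphere_measure_inner_Basis[OF _ e, of "\<lambda>t. ennreal (w t) * indicator E t"] n by simp
  also have "(\<integral>\<^sup>+t. ennreal (w t) * indicator E t \<partial>height_measure (real n) 0)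
      = emeasure (height_measure (a1 + real n) a2) E"
    by (auto simp: nn_integral_height_measure emeasure_height_measure indicator_def density
        ennreal_mult''[symmetric] intro!: nn_integral_cong arg_cong[where f = ennreal])
  finally show ?thesis .
qed

subsection \<open>Great spheres\<close>

abbreviation row_span :: "real^'m^'k \<Rightarrow> (real^'m) set" where
  "row_span w \<equiv> span (range (\<lambda>j. w $ j))"

lemma linear_vector_matrix_mult: "linear (\<lambda>c. c v* (w :: real^'m^'k))"
  by (rule linearI) (simp_all add: vector_matrix_left_distrib scaleR_vector_matrix_assoc)

lemma sum_scaleR_rows: "(\<Sum>j\<in>UNIV. c $ j *\<^sub>R w $ j) = c v* (w :: real^'m^'k)"
  by (simp add: vec_eq_iff vector_matrix_mult_def)

lemma axis_vector_matrix_mult: "axis j 1 v* w = (w :: real^'m^'k) $ j"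
  by (simp add: sum_scaleR_rows[symmetric] axis_def if_distrib[of "\<lambda>r. r *\<^sub>R _"] cong: if_cong)

lemma row_span_eq_range: "row_span w = range (\<lambda>c. c v* w)"
proof
  have "range (\<lambda>j. w $ j) \<subseteq> range (\<lambda>c. c v* w)"
    using axis_vector_matrix_mult[of _ w] by (metis image_subset_iff rangeI)
  then show "row_span w \<subseteq> range (\<lambda>c. c v* w)"
    by (rule span_minimal) (simp add: linear_subspace_image linear_vector_matrix_mult)
  show "range (\<lambda>c. c v* w) \<subseteq> row_span w"
    unfolding sum_scaleR_rows[symmetric] by (intro image_subsetI span_sum span_scale span_base) auto
qed

lemma frame_matrix_vector_mult:
  fixes u :: "real^'m^'k"
  assumes "onframe u V"
  shows "u *v (c v* u) = c"
  using assms by (simp add: onframe_def vec_eq_iff matrix_vector_mul_component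
      sum_scaleR_rows[symmetric] inner_sum_right if_distrib[of "\<lambda>r. _ * r"] cong: if_cong)

lemma norm_frame_combination:
  fixes u :: "real^'m^'k"
  assumes "onframe u V"
  shows "norm (c v* u) = norm c"
  using frame_matrix_vector_mult[OF assms, of c] by (simp add: norm_eq_sqrt_inner dot_lmul_matrix)

lemma ex_projection_subspace:
  fixes e :: "'a::euclidean_space"
  assumes "subspace V"
  obtains y where "y \<in> V" "\<And>x. x \<in> V \<Longrightarrow> x \<bullet> e = x \<bullet> y"
proof -
  obtain y z where yz: "y \<in> span V" "\<And>x. x \<in> span V \<Longrightarrow> orthogonal z x" "e = y + z"
    using orthogonal_subspace_decomp_exists[of V e] by metis
  show thesis
  proof
    show "y \<in> V" using yz(1) assms by (simp add: span_eq_iff[THEN iffD2])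
    fix x assume "x \<in> V"
    then have "x \<bullet> z = 0" using yz(2) by (simp add: span_base orthogonal_def inner_commute)
    then show "x \<bullet> e = x \<bullet> y" by (simp add: yz(3) inner_add_right)
  qed
qed

lemma norm_projection_le:
  fixes e y :: "'a::real_inner"
  assumes "y \<bullet> e = y \<bullet> y"
  shows "norm y \<le> norm e"
proof (cases "y = 0")
  case False
  have "norm y * norm y \<le> norm y * norm e"
    using norm_cauchy_schwarz[of y e] assms by (simp add: power2_norm_eq_inner[symmetric] power2_eq_square)
  then show ?thesis using False by simp
qed simp

text \<open>The point of the great sphere nearest to \<open>e\<close> is \<open>y /\<^sub>R norm y\<close>, or any point if \<open>y = 0\<close>.\<close>
lemma dist_origin_eq_arccos_norm_projection:
  fixes e y :: "'a::euclidean_space"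
  assumes V: "subspace V" "V \<noteq> {0}" and e: "norm e = 1"
    and y: "y \<in> V" "\<And>x. x \<in> V \<Longrightarrow> x \<bullet> e = x \<bullet> y"
  shows "dist_origin e V = arccos (norm y)"
  unfolding dist_origin_def
proof (rule cInf_eq_minimum)
  have norm_y: "norm y \<le> 1" using norm_projection_le[of y e] y e by simp
  obtain x where x: "x \<in> V" "norm x = 1" "x \<bullet> e = norm y"
  proof (cases "y = 0")
    case True
    obtain v where v: "v \<in> V" "v \<noteq> 0" using V subspace_0 by blast
    then have "v /\<^sub>R norm v \<in> V" using V(1) by (simp add: subspace_mul)
    then show thesis using that[of "v /\<^sub>R norm v"] v y(2)[of "v /\<^sub>R norm v"] True by simp
  next
    case False
    have "y /\<^sub>R norm y \<in> V" using V(1) y(1) by (simp add: subspace_mul)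
    then show thesis
      using that[of "y /\<^sub>R norm y"] y(2)[of "y /\<^sub>R norm y"] False
      by (simp add: power2_norm_eq_inner[symmetric] power2_eq_square)
  qed
  then show "arccos (norm y) \<in> sph_dist e ` great_sphere V"
    by (auto simp: great_sphere_def sph_dist_def image_iff inner_commute intro!: bexI[of _ x])
  fix d assume "d \<in> sph_dist e ` great_sphere V"
  then obtain z where z: "z \<in> V" "norm z = 1" "d = arccos (z \<bullet> e)"
    by (auto simp: great_sphere_def sph_dist_def inner_commute)
  have "z \<bullet> e \<le> norm y" using norm_cauchy_schwarz[of z y] z y(2) by simp
  moreover have "\<bar>z \<bullet> e\<bar> \<le> 1" using Cauchy_Schwarz_ineq2[of z e] e z(2) by simp
  ultimately show "arccos (norm y) \<le> d" unfolding z(3) using norm_y by (intro arccos_le_arccos) auto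
qed

lemma dist_origin_projection:
  fixes e :: "'a::euclidean_space"
  assumes V: "subspace V" "V \<noteq> {0}" and e: "norm e = 1"
  obtains y where "y \<in> V" "\<And>x. x \<in> V \<Longrightarrow> x \<bullet> e = x \<bullet> y"
    "norm y \<le> 1" "dist_origin e V = arccos (norm y)" "cos (dist_origin e V) = norm y"
proof -
  obtain y :: 'a where y: "y \<in> V" "\<And>x. x \<in> V \<Longrightarrow> x \<bullet> e = x \<bullet> y"
    using ex_projection_subspace[OF V(1)] by metis
  moreover have "norm y \<le> 1" using norm_projection_le[of y e] y e by simp
  ultimately show thesis
    using that dist_origin_eq_arccos_norm_projection[OF V e y]
    by (simp add: cos_arccos order_trans[OF _ norm_ge_zero])
qed

lemma inner_le_cos_dist_origin:
  fixes e :: "'a::euclidean_space"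
  assumes "subspace V" "norm e = 1" "x \<in> V"
  shows "x \<bullet> e \<le> cos (dist_origin e V) * norm x"
proof (cases "x = 0")
  case False
  then have "V \<noteq> {0}" using assms by blast
  then obtain y :: 'a where "\<And>x. x \<in> V \<Longrightarrow> x \<bullet> e = x \<bullet> y" "cos (dist_origin e V) = norm y"
    using dist_origin_projection[OF assms(1) _ assms(2)] by metis
  then show ?thesis using norm_cauchy_schwarz[of x y] assms by (simp add: mult.commute)
qed simp

lemma cos_dist_origin_less:
  fixes e :: "'a::euclidean_space"
  assumes V: "subspace V" "V \<noteq> {0}" and e: "norm e = 1" and \<beta>: "0 < \<beta>"
    and less: "\<And>x. x \<in> V \<Longrightarrow> x \<noteq> 0 \<Longrightarrow> x \<bullet> e < \<beta> * norm x"
  shows "cos (dist_origin e V) < \<beta>"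
proof -
  obtain y :: 'a where y: "y \<in> V" "y \<bullet> e = y \<bullet> y" "cos (dist_origin e V) = norm y"
    using dist_origin_projection[OF V e] by metis
  show ?thesis
  proof (cases "y = 0")
    case False
    then have "norm y * norm y < \<beta> * norm y"
      using less[OF y(1)] y(2) by (simp add: power2_norm_eq_inner[symmetric] power2_eq_square)
    then show ?thesis using False y(3) by simp
  qed (use y \<beta> in simp)
qed

lemma sin_dist_origin_powr:
  fixes e :: "'a::euclidean_space"
  assumes V: "subspace V" "V \<noteq> {0}" and e: "norm e = 1"
  shows "sin (dist_origin e V) powr \<gamma> = (1 - (cos (dist_origin e V))\<^sup>2) powr (\<gamma> / 2)"
proof -
  obtain y :: 'a where y: "norm y \<le> 1" "dist_origin e V = arccos (norm y)" "cos (dist_origin e V) = norm y"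
    using dist_origin_projection[OF V e] by metis
  then have "sin (dist_origin e V) = sqrt (1 - (cos (dist_origin e V))\<^sup>2)"
    by (simp add: sin_arccos_abs)
  then show ?thesis
    using y by (simp add: powr_half_sqrt[symmetric] powr_powr power_le_one)
qed

lemma Xi_imp_nontrivial: "Xi e k V \<Longrightarrow> subspace V \<and> V \<noteq> {0}"
  by (auto simp: Xi_def)

lemma Xi_imp_cos_dist_origin_pos:
  fixes e :: "'a::euclidean_space"
  assumes "Xi e k V" "norm e = 1"
  shows "0 < cos (dist_origin e V)"
proof -
  obtain y :: 'a where "dist_origin e V = arccos (norm y)" "cos (dist_origin e V) = norm y"
    using dist_origin_projection[of V e] Xi_imp_nontrivial[OF assms(1)] assms(2) by metis
  then show ?thesis using assms(1) by (cases "y = 0") (auto simp: Xi_def)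
qed

lemma cos_dist_origin_less_1:
  fixes e :: "'a::euclidean_space"
  assumes "Xi e k V" "norm e = 1" "e \<notin> V"
  shows "cos (dist_origin e V) < 1"
proof -
  obtain y :: 'a where y: "y \<in> V" "y \<bullet> e = y \<bullet> y" "norm y \<le> 1" "cos (dist_origin e V) = norm y"
    using dist_origin_projection[of V e] Xi_imp_nontrivial[OF assms(1)] assms(2) by metis
  have "norm y \<noteq> 1"
  proof
    assume "norm y = 1"
    then have "(e - y) \<bullet> (e - y) = 0"
      using y(2) assms(2) by (simp add: inner_diff_left inner_diff_right inner_commute norm_eq_1)
    then show False using y(1) assms(3) by simp
  qed
  then show ?thesis using y by simp
qed

lemma XiI:
  fixes e :: "'a::euclidean_space"
  assumes "subspace V" "dim V = k + 1" "norm e = 1" "0 < cos (dist_origin e V)"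
  shows "Xi e k V"
proof -
  have "V \<noteq> {0}" using assms(2) by auto
  then obtain y :: 'a where y: "norm y \<le> 1" "dist_origin e V
      = arccos (norm y)" "cos (dist_origin e V) = norm y"
    using dist_origin_projection[of V e] assms by metis
  then have "arccos (norm y) < arccos 0" using assms(4) by (intro arccos_less_arccos) auto
  then show ?thesis using assms y by (simp add: Xi_def)
qed

subsection \<open>Almost every plane\<close>

lemma AE_lborel_imp_ex_in_open:
  fixes U :: "'a::euclidean_space set"
  assumes "AE x in lborel. P x" "open U" "U \<noteq> {}"
  obtains x where "x \<in> U" "P x"
proof (rule ccontr)
  assume "\<not> thesis"
  then have "\<And>x. P x \<Longrightarrow> x \<notin> U" using that by blast
  then have "AE x in lborel. x \<notin> U" using assms(1) by (rule eventually_mono[rotated])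
  then have "U \<in> null_sets lborel" using assms(2) by (simp add: AE_iff_null_sets)
  then have "negligible U" by (simp add: negligible_iff_null_sets null_sets_completionI)
  then show False using open_not_negligible assms by blast
qed

lemma ex_orthonormal_rows_at_height:
  fixes i0 :: "'m::finite" and j0 :: "'k::finite"
  assumes card: "CARD('k) < CARD('m)" and c: "0 < c" "c < 1"
  obtains w :: "real^'m^'k" where "\<And>a. norm (a v* w) = norm a" "\<And>a. (a v* w) \<bullet> axis i0 1 = a $ j0 * c"
proof -
  define e where "e = (axis i0 1 :: real^'m)"
  have "card (UNIV :: 'k set) \<le> card (UNIV - {i0})" using card by (simp add: card_Diff_subset)
  then obtain \<iota> :: "'k \<Rightarrow> 'm" where \<iota>: "range \<iota> \<subseteq> UNIV - {i0}" "inj \<iota>"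
    using card_le_inj[of "UNIV :: 'k set" "UNIV - {i0}"] by auto
  then have \<iota>_neq: "\<iota> j \<noteq> i0" "i0 \<noteq> \<iota> j" and \<iota>_eq_iff: "\<iota> i = \<iota> j \<longleftrightarrow> i = j" for i j
    by (auto simp: inj_on_def)
  define w :: "real^'m^'k" where
    "w = (\<chi> j. if j = j0 then c *\<^sub>R e + sqrt (1 - c\<^sup>2) *\<^sub>R axis (\<iota> j) 1 else axis (\<iota> j) 1)"
  have "c * c \<le> 1" using c by (simp add: mult_le_one)
  then have "onframe w (row_span w)"
    unfolding onframe_def w_def e_def
    by (auto simp: inner_add_left inner_add_right inner_axis_axis \<iota>_neq \<iota>_eq_iff power2_eq_square)
  moreover have "w $ j \<bullet> e = (if j = j0 then c else 0)" for j
    by (simp add: w_def e_def inner_add_left inner_axis_axis \<iota>_neq)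
  then have "(a v* w) \<bullet> e = a $ j0 * c" for a
    by (simp add: sum_scaleR_rows[symmetric] inner_sum_left if_distrib[of "\<lambda>r. _ * r"] cong: if_cong)
  ultimately show thesis using that norm_frame_combination unfolding e_def by blast
qed

lemma continuous_on_vector_matrix_mult:
  "continuous_on UNIV (\<lambda>(w :: real^'m^'k, a). a v* w)"
  unfolding vector_matrix_mult_def case_prod_beta by (intro continuous_intros)

lemma Xi_row_span_height_between:
  fixes w :: "real^'m^'k" and e :: "real^'m"
  assumes k: "CARD('k::finite) = k + 1" and e: "norm e = 1" and \<alpha>\<beta>: "0 < \<alpha>" "0 < \<beta>"
    and row: "\<alpha> * norm (w $ j) < w $ j \<bullet> e"
    and below: "\<And>a. a \<noteq> 0 \<Longrightarrow> (a v* w) \<bullet> e < \<beta> * norm (a v* w)"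
  shows "Xi e k (row_span w) \<and> \<alpha> < cos (dist_origin e (row_span w)) \<and> cos (dist_origin e (row_span w)) < \<beta>"
proof -
  have "inj (\<lambda>c. c v* w)"
    using below by (subst linear_injective_0[OF linear_vector_matrix_mult]) fastforce
  then have dim: "dim (row_span w) = k + 1"
    unfolding row_span_eq_range using dim_image_eq[OF linear_vector_matrix_mult, of w UNIV] k by simp
  have "w $ j \<in> row_span w" by (simp add: span_base)
  then have "\<alpha> * norm (w $ j) < cos (dist_origin e (row_span w)) * norm (w $ j)"
    using row inner_le_cos_dist_origin[of "row_span w" e "w $ j"] e by simp
  then have "\<alpha> < cos (dist_origin e (row_span w))"
    by (rule mult_right_less_imp_less[OF _ norm_ge_zero])
  moreover have "cos (dist_origin e (row_span w)) < \<beta>"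
  proof (rule cos_dist_origin_less)
    show "row_span w \<noteq> {0}"
    proof
      assume "row_span w = {0}"
      from arg_cong[OF this, of dim] show False unfolding dim by simp
    qed
    fix x assume x: "x \<in> row_span w" "x \<noteq> 0"
    then obtain a where "x = a v* w" unfolding row_span_eq_range by blast
    then show "x \<bullet> e < \<beta> * norm x" using below[of a] x(2) by (cases "a = 0") simp_all
  qed (use e \<alpha>\<beta> subspace_span in simp_all)
  ultimately show ?thesis using XiI[OF _ dim e] \<alpha>\<beta> by auto
qed

text \<open>Both assumptions of \<open>Xi_row_span_height_between\<close> are open in \<open>w\<close>, the second one because it suffices to
  consider \<open>a\<close> in the compact unit sphere.\<close>
lemma ex_open_Xi_height_between:
  fixes i0 :: "'m::finite"
  defines "e \<equiv> axis i0 1 :: real^'m"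
  assumes card: "CARD('k::finite) < CARD('m)" "CARD('k) = k + 1" and \<alpha>\<beta>: "0 < \<alpha>" "\<alpha> < \<beta>" "\<beta> < 1"
  obtains U :: "(real^'m^'k) set" where "open U" "U \<noteq> {}"
    "\<And>w. w \<in> U \<Longrightarrow> Xi e k (row_span w) \<and> \<alpha> < cos (dist_origin e (row_span w))
        \<and> cos (dist_origin e (row_span w)) < \<beta>"
proof -
  define c where "c = (\<alpha> + \<beta>) / 2"
  have c: "\<alpha> < c" "c < \<beta>" "0 < c" "c < 1" using \<alpha>\<beta> by (auto simp: c_def)
  obtain j :: 'k where True by simp
  obtain w0 :: "real^'m^'k" where w0: "\<And>a. norm (a v* w0) = norm a" "\<And>a. (a v* w0) \<bullet> e = a $ j * c"
    unfolding e_def using ex_orthonormal_rows_at_height[OF card(1) c(3,4)] by blast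
  define below where "below = {(w :: real^'m^'k, a). (a v* w) \<bullet> e < \<beta> * norm (a v* w)}"
  have open_below: "open below"
    unfolding below_def case_prod_beta using continuous_on_vector_matrix_mult[where 'm = 'm and 'k = 'k]
    by (intro open_Collect_less continuous_intros) (auto simp: case_prod_beta)
  have w0_below: "{w0} \<times> sphere 0 1 \<subseteq> below"
  proof clarify
    fix a :: "real^'k" assume a: "a \<in> sphere 0 1"
    have "a $ j * c \<le> 1 * c" using component_le_norm_cart[of a j] a c by (intro mult_right_mono) auto
    then have "a $ j * c < \<beta>" using c by linarith
    then show "(w0, a) \<in> below" using a by (simp add: below_def w0)
  qed
  obtain U where U: "w0 \<in> U" "open U" "U \<times> sphere 0 1 \<subseteq> below"
    using Elementary_Topology.tube_lemma[OF compact_sphere open_below w0_below] by blast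
  define above where "above = {w :: real^'m^'k. \<alpha> * norm (w $ j) < w $ j \<bullet> e}"
  have "open above" unfolding above_def by (intro open_Collect_less continuous_intros)
  moreover have "w0 \<in> above"
    using w0[of "axis j 1"] c by (simp add: above_def axis_vector_matrix_mult)
  moreover have "Xi e k (row_span w) \<and> \<alpha> < cos (dist_origin e (row_span w))
      \<and> cos (dist_origin e (row_span w)) < \<beta>"
    if w: "w \<in> U \<inter> above" for w
  proof (rule Xi_row_span_height_between)
    show "\<alpha> * norm (w $ j) < w $ j \<bullet> e" using w by (simp add: above_def)
    fix a :: "real^'k" assume "a \<noteq> 0"
    then have "(w, a /\<^sub>R norm a) \<in> below" using U(3) w by auto
    then show "(a v* w) \<bullet> e < \<beta> * norm (a v* w)"
      using \<open>a \<noteq> 0\<close> by (simp add: below_def scaleR_vector_matrix_assoc field_simps)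
  qed (use card \<alpha>\<beta> in \<open>auto simp: e_def\<close>)
  ultimately show thesis using that[of "U \<inter> above"] U by blast
qed

lemma orthogonal_transformation_rows:
  fixes T :: "real^'m \<Rightarrow> real^'m"
  assumes T: "orthogonal_transformation T"
  shows "orthogonal_transformation (\<lambda>w :: real^'m^'k. \<chi> j. T (w $ j))"
  unfolding orthogonal_transformation_def
proof (intro conjI allI)
  have lin: "linear T" using T by (rule orthogonal_transformation_linear)
  show "linear (\<lambda>w :: real^'m^'k. \<chi> j. T (w $ j))"
    by (rule linearI) (simp_all add: vec_eq_iff linear_add[OF lin] linear_scale[OF lin])
  show "(\<chi> j. T (v $ j)) \<bullet> (\<chi> j. T (w $ j)) = v \<bullet> w" for v w :: "real^'m^'k"
    using T by (simp add: inner_vec_def[where 'b = 'k] orthogonal_transformation_def)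
qed

lemma row_span_linear_image_iff:
  fixes T :: "real^'m \<Rightarrow> real^'m" and w :: "real^'m^'k"
  assumes "linear T" "inj T"
  shows "T x \<in> row_span (\<chi> j. T (w $ j)) \<longleftrightarrow> x \<in> row_span w"
proof -
  have "c v* (\<chi> j. T (w $ j)) = T (c v* w)" for c :: "real^'k"
    by (simp add: sum_scaleR_rows[symmetric] linear_sum[OF assms(1)] linear_scale[OF assms(1)])
  then show ?thesis
    unfolding row_span_eq_range using assms(2) by (auto simp: inj_eq)
qed

lemma borel_row_span_pairs: "{(w :: real^'m^'k, x). x \<in> row_span w} \<in> sets borel"
proof -
  define f where "f = (\<lambda>(w :: real^'m^'k, a). (w, a v* w))"
  have cont: "continuous_on S f" for S
    using continuous_on_vector_matrix_mult[where 'm = 'm and 'k = 'k]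
    unfolding f_def case_prod_beta by (intro continuous_intros) (auto intro: continuous_on_subset)
  have "{(w :: real^'m^'k, x). x \<in> row_span w} = range f"
    by (auto simp: f_def row_span_eq_range)
  also have "\<dots> = (\<Union>n::nat. f ` cball 0 (real n))"
  proof -
    have "x \<in> cball 0 (real (nat \<lceil>norm x\<rceil>))" for x :: "(real^'m^'k) \<times> (real^'k)"
      by (simp add: real_nat_ceiling_ge)
    then show ?thesis by blast
  qed
  also have "\<dots> \<in> sets borel"
    by (intro sets.countable_UN) (auto intro!: borel_compact compact_continuous_image cont)
  finally show ?thesis .
qed

text \<open>A fixed subspace of less than full dimension misses almost every vector, so by Fubini's theorem
  almost every vector lies outside almost every row span. By rotation invariance all nonzero vectors
  behave alike.\<close>
lemma AE_not_in_row_span: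
  fixes e :: "real^'m"
  assumes card: "CARD('k::finite) < CARD('m)" and e: "e \<noteq> 0"
  shows "AE w in (lborel :: (real^'m^'k) measure). e \<notin> row_span w"
proof -
  have pairs[measurable]: "Measurable.pred (lborel \<Otimes>\<^sub>M lborel) (\<lambda>(w :: real^'m^'k, x). x \<notin> row_span w)"
    using borel_comp[OF borel_row_span_pairs[where 'm = 'm and 'k = 'k]]
    by (simp add: pred_def lborel_prod case_prod_beta' Collect_neg_eq)
  have "AE x in lborel. x \<notin> row_span w" for w :: "real^'m^'k"
  proof -
    have "dim (row_span w) \<le> card (range (\<lambda>j. w $ j))" by (simp add: dim_le_card')
    also have "\<dots> \<le> CARD('k)" by (rule card_image_le) simp
    finally have "negligible (row_span w)" using card by (intro negligible_lowdim) simp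
    then have "row_span w \<in> null_sets lborel"
      by (simp add: negligible_iff_null_sets null_sets_completion_iff closed_span borel_closed)
    then show ?thesis by (rule AE_not_in)
  qed
  then have misses: "AE x in lborel. AE w in (lborel :: (real^'m^'k) measure). x \<notin> row_span w"
    using lborel_pair.AE_commute[of "\<lambda>(w :: real^'m^'k) x. x \<notin> row_span w"] pairs
    by (simp add: pred_def case_prod_beta)
  have "- {0} \<noteq> ({} :: (real^'m) set)" using e by blast
  then obtain x where x: "x \<noteq> 0" "AE w in (lborel :: (real^'m^'k) measure). x \<notin> row_span w"
    using AE_lborel_imp_ex_in_open[OF misses open_Compl[OF closed_singleton]] by blast
  obtain T where T: "orthogonal_transformation T" "T x = (norm x / norm e) *\<^sub>R e"
    using orthogonal_transformation_exists[of x "(norm x / norm e) *\<^sub>R e"] e by auto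
  have "AE w in distr lborel borel (\<lambda>w :: real^'m^'k. \<chi> j. T (w $ j)). T x \<notin> row_span w"
  proof (subst AE_distr_iff)
    show "(\<lambda>w :: real^'m^'k. \<chi> j. T (w $ j)) \<in> measurable lborel borel"
      using borel_measurable_orthogonal_transformation[OF orthogonal_transformation_rows[OF T(1)]] by simp
    show "{w :: real^'m^'k \<in> space borel. T x \<notin> row_span w} \<in> sets borel"
      using measurable_compose[OF measurable_Pair1' pairs] by (simp add: pred_def)
    show "AE w in (lborel :: (real^'m^'k) measure). T x \<notin> row_span (\<chi> j. T (w $ j))"
      using x(2) T(1)
      by (simp only: row_span_linear_image_iff orthogonal_transformation_linear orthogonal_transformation_inj)
  qed
  then have "AE w in (lborel :: (real^'m^'k) measure). T x \<notin> row_span w"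
    unfolding distr_lborel_orthogonal_transformation[OF orthogonal_transformation_rows[OF T(1)]] .
  then show ?thesis
    by (rule eventually_mono) (auto simp: T(2) span_scale)
qed

subsection \<open>The Radon transform of a function of the height\<close>

lemma onframe_exists:
  fixes V :: "(real^'m) set"
  assumes "subspace V" "dim V = CARD('k::finite)"
  obtains u :: "real^'m^'k" where "onframe u V"
proof -
  obtain B where B: "pairwise orthogonal B" "\<And>x. x \<in> B \<Longrightarrow> norm x = 1"
      "independent B" "card B = dim V" "span B = V"
    using orthonormal_basis_subspace[OF assms(1)] by metis
  have "finite B" using B(3) by (rule independent_imp_finite)
  then obtain h :: "'k \<Rightarrow> real^'m" where h: "bij_betw h UNIV B"
    using B(4) assms(2) finite_same_card_bij[of "UNIV :: 'k set" B] by auto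
  have "h i \<bullet> h j = (if i = j then 1 else 0)" for i j
  proof (cases "i = j")
    case True
    then show ?thesis using B(2)[of "h i"] h by (auto simp: bij_betw_def norm_eq_1)
  next
    case False
    then have "h i \<noteq> h j" using h by (auto simp: bij_betw_def inj_on_def)
    then show ?thesis using B(1) h False by (auto simp: pairwise_def orthogonal_def bij_betw_def)
  qed
  moreover have "range h = B" using h by (simp add: bij_betw_def)
  ultimately have "onframe (\<chi> j. h j) V" using B(5) by (simp add: onframe_def)
  then show thesis by (rule that)
qed

lemma inner_radon_param:
  fixes V :: "(real^'m) set"
  assumes V: "subspace V" "dim V = CARD('k::finite)" and e: "norm e = 1"
  obtains v :: "real^'k" where "norm v = cos (dist_origin e V)" "\<And>c. radon_param TYPE('k) V c \<bullet> e = c \<bullet> v"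
proof -
  define u :: "real^'m^'k" where "u = (SOME u. onframe u V)"
  have u: "onframe u V" unfolding u_def using onframe_exists[OF V] by (metis someI_ex)
  have V_eq: "V = range (\<lambda>c. c v* u)"
    using u row_span_eq_range[of u] by (simp add: onframe_def)
  define v where "v = u *v e"
  have "norm (v v* u) \<le> 1 \<and> dist_origin e V = arccos (norm (v v* u))"
  proof -
    have "x \<bullet> e = x \<bullet> (v v* u)" if "x \<in> V" for x
      using that by (auto simp: V_eq v_def dot_lmul_matrix frame_matrix_vector_mult[OF u])
    moreover have "V \<noteq> {0}" using V(2) by auto
    moreover have "v v* u \<in> V" by (simp add: V_eq)
    ultimately show ?thesis
      using V(1) e norm_projection_le[of "v v* u" e] dist_origin_eq_arccos_norm_projection by auto
  qed
  then have "norm v = cos (dist_origin e V)"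
    by (simp add: norm_frame_combination[OF u] cos_arccos order_trans[OF _ norm_ge_zero])
  moreover have "radon_param TYPE('k) V c \<bullet> e = c \<bullet> v" for c
    unfolding radon_param_def u_def[symmetric] Let_def v_def by (simp add: sum_scaleR_rows dot_lmul_matrix)
  ultimately show thesis by (rule that)
qed

lemma
  fixes V :: "(real^'m) set" and F :: "real \<Rightarrow> real"
  assumes F: "F \<in> borel_measurable borel" and V: "subspace V" "dim V = CARD('k::finite)"
    and e: "norm e = 1" and k: "CARD('k) = k + 1" "1 \<le> k"
  shows radon_integrable_height_iff: "radon_integrable TYPE('k) (\<lambda>x. F \<bar>x \<bullet> e\<bar>) V \<longleftrightarrow>
      integrable (height_measure (real k) 0) (\<lambda>t. F (cos (dist_origin e V) * t))"
    and radon_height: "radon TYPE('k) (\<lambda>x. F \<bar>x \<bullet> e\<bar>) V =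
      height_const k * (\<integral>t. F (cos (dist_origin e V) * t) \<partial>height_measure (real k) 0)"
proof -
  obtain v :: "real^'k" where v: "norm v = cos (dist_origin e V)" "\<And>c. radon_param TYPE('k) V c \<bullet> e = c \<bullet> v"
    using inner_radon_param[OF V e] by metis
  show "radon_integrable TYPE('k) (\<lambda>x. F \<bar>x \<bullet> e\<bar>) V \<longleftrightarrow>
      integrable (height_measure (real k) 0) (\<lambda>t. F (cos (dist_origin e V) * t))"
    and "radon TYPE('k) (\<lambda>x. F \<bar>x \<bullet> e\<bar>) V =
      height_const k * (\<integral>t. F (cos (dist_origin e V) * t) \<partial>height_measure (real k) 0)"
    using integrable_sphere_measure_inner_iff[OF F, of v] integral_sphere_measure_inner[OF F, of v] k
    by (simp_all add: radon_integrable_def radon_def v)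
qed

subsection \<open>Lorentz norms\<close>

lemma
  fixes g :: "'a \<Rightarrow> real"
  assumes M: "sigma_finite_measure M" and [measurable]: "g \<in> borel_measurable M"
  shows nn_integral_layer_cake:
      "(\<integral>\<^sup>+x. ennreal (g x) \<partial>M) = (\<integral>\<^sup>+s. indicator {0<..} s * emeasure M {x \<in> space M. g x > s} \<partial>lborel)"
    and borel_measurable_emeasure_level:
      "(\<lambda>s. emeasure M {x \<in> space M. g x > s}) \<in> borel_measurable borel"
proof -
  interpret M: sigma_finite_measure M by fact
  interpret pair_sigma_finite M "lborel :: real measure" ..
  define below :: "real \<Rightarrow> 'a \<Rightarrow> ennreal" where "below s x = (if s < g x then 1 else 0)" for s x
  have below: "(\<lambda>(x, s). below s x) \<in> borel_measurable (M \<Otimes>\<^sub>M lborel)"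
    unfolding below_def by measurable
  have level: "(\<integral>\<^sup>+x. below s x \<partial>M) = emeasure M {x \<in> space M. g x > s}" for s
  proof -
    have "(\<integral>\<^sup>+x. below s x \<partial>M) = (\<integral>\<^sup>+x. indicator {x \<in> space M. g x > s} x \<partial>M)"
      by (rule nn_integral_cong) (auto simp: below_def)
    then show ?thesis by simp
  qed
  have "(\<lambda>s. \<integral>\<^sup>+x. below s x \<partial>M) \<in> borel_measurable lborel"
    using measurable_pair_swap[OF below] by (intro M.borel_measurable_nn_integral) (simp add: case_prod_beta')
  then show "(\<lambda>s. emeasure M {x \<in> space M. g x > s}) \<in> borel_measurable borel"
    by (simp add: level)
  have "ennreal (g x) = (\<integral>\<^sup>+s. indicator {0<..} s * below s x \<partial>lborel)" for x
  proof -
    have "(\<integral>\<^sup>+s. indicator {0<..} s * below s x \<partial>lborel) = (\<integral>\<^sup>+s. indicator {0<..<g x} s \<partial>lborel)"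
      by (intro nn_integral_cong) (auto simp: indicator_def below_def)
    also have "\<dots> = ennreal (g x)" by (cases "0 \<le> g x") (auto simp: ennreal_neg)
    finally show ?thesis by simp
  qed
  then have "(\<integral>\<^sup>+x. ennreal (g x) \<partial>M) = (\<integral>\<^sup>+x. \<integral>\<^sup>+s. indicator {0<..} s * below s x \<partial>lborel \<partial>M)"
    by simp
  also have "\<dots> = (\<integral>\<^sup>+s. \<integral>\<^sup>+x. indicator {0<..} s * below s x \<partial>M \<partial>lborel)"
    using below by (intro Fubini'[symmetric]) (simp add: case_prod_beta)
  also have "\<dots> = (\<integral>\<^sup>+s. indicator {0<..} s * emeasure M {x \<in> space M. g x > s} \<partial>lborel)"
    using below by (simp add: nn_integral_cmult level[symmetric])
  finally show "(\<integral>\<^sup>+x. ennreal (g x) \<partial>M) = \<dots>" .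
qed

lemma nn_integral_le_lorentz_norm:
  fixes f :: "'a \<Rightarrow> real" and g :: "'b \<Rightarrow> real"
  assumes N: "sigma_finite_measure N" and g[measurable]: "g \<in> borel_measurable N" and p: "p \<ge> 0"
    and levels: "\<And>s. s > 0 \<Longrightarrow> ennreal b * emeasure N {x \<in> space N. \<bar>g x\<bar> > s}
      \<le> epowr (emeasure M {x \<in> space M. \<bar>f x\<bar> > s}) (1 / p)"
  shows "ennreal (p * b) * (\<integral>\<^sup>+x. ennreal \<bar>g x\<bar> \<partial>N) \<le> lorentz_norm p M f"
proof -
  have [measurable]: "(\<lambda>s. emeasure N {x \<in> space N. \<bar>g x\<bar> > s}) \<in> borel_measurable borel"
    using N by (rule borel_measurable_emeasure_level) measurable
  have "ennreal b * (\<integral>\<^sup>+x. ennreal \<bar>g x\<bar> \<partial>N)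
      = (\<integral>\<^sup>+s. ennreal b * (indicator {0<..} s * emeasure N {x \<in> space N. \<bar>g x\<bar> > s}) \<partial>lborel)"
    by (simp add: nn_integral_layer_cake[OF N] nn_integral_cmult)
  also have "\<dots> \<le> (\<integral>\<^sup>+s. indicator {0<..} s * epowr (emeasure M {x \<in> space M. \<bar>f x\<bar> > s}) (1 / p) \<partial>lborel)"
    using levels by (intro nn_integral_mono) (auto simp: indicator_def)
  finally show ?thesis
    using p by (simp add: lorentz_norm_def ennreal_mult' mult.assoc mult_left_mono)
qed

lemma lorentz_norm_indicator:
  assumes p: "p > 0" and E: "E \<in> sets M"
  shows "lorentz_norm p M (indicator E) = ennreal p * epowr (emeasure M E) (1 / p)"
proof -
  have "{x \<in> space M. \<bar>indicator E x :: real\<bar> > s} = (if s < 1 then E else {})" if "0 < s" for s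
    using that sets.sets_into_space[OF E] by (auto simp: indicator_def split: if_splits)
  then have "indicator {0<..} s * epowr (emeasure M {x \<in> space M. \<bar>indicator E x :: real\<bar> > s}) (1 / p)
      = epowr (emeasure M E) (1 / p) * indicator {0<..<1} s" for s
    by (cases "0 < s") (auto simp: indicator_def epowr_def)
  then show ?thesis
    by (simp add: lorentz_norm_def nn_integral_cmult)
qed

subsection \<open>From the dilation estimate to the Radon transform\<close>

lemma dilation_estimate_imp_nn_integral_le_lorentz_norm:
  fixes e :: "'a::euclidean_space"
  assumes estimate: "dilation_estimate (sets borel) k (a1 + real n) (1 + a2) g1 g2"
    and k: "k > 0" and a2: "a2 > 0" and e: "e \<in> Basis" and n: "DIM('a) = n + 1" "n \<ge> 1"
  obtains B :: real where "B > 0"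
    "\<And>F c. \<lbrakk>F \<in> borel_measurable borel; 0 < c; c < 1\<rbrakk> \<Longrightarrow>
      ennreal (B * ((1 - c\<^sup>2) powr (g1 / 2) * c powr g2)) * (\<integral>\<^sup>+t. ennreal \<bar>F (c * t)\<bar> \<partial>height_measure k 0)
        \<le> lorentz_norm (1 + a2) (weighted_sphere e a1 a2) (\<lambda>x. F \<bar>x \<bullet> e\<bar>)"
proof -
  define p where "p = 1 + a2"
  have p: "p > 1" using a2 by (simp add: p_def)
  obtain K where K: "K > 0" and dilation: "\<And>E c. \<lbrakk>E \<in> sets borel; c \<in> {0<..<1}\<rbrakk> \<Longrightarrow>
     ennreal (K * (1 - c\<^sup>2) powr (g1 / 2) * c powr g2) * emeasure (height_measure k 0) {t. c * t \<in> E}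
       \<le> epowr (emeasure (height_measure (a1 + real n) a2) E) (1 / p)"
    using estimate unfolding dilation_estimate_def p_def by auto
  define H where "H = height_const n powr (1 / p)"
  have const: "height_const n > 0" using n by (intro height_const_pos) auto
  have "ennreal (p * (H * K) * ((1 - c\<^sup>2) powr (g1 / 2) * c powr g2)) *
      (\<integral>\<^sup>+t. ennreal \<bar>F (c * t)\<bar> \<partial>height_measure k 0)
      \<le> lorentz_norm p (weighted_sphere e a1 a2) (\<lambda>x. F \<bar>x \<bullet> e\<bar>)"
    if F[measurable]: "F \<in> borel_measurable borel" and c: "0 < c" "c < 1" for F c
  proof -
    have "ennreal (p * (H * (K * (1 - c\<^sup>2) powr (g1 / 2) * c powr g2))) *
        (\<integral>\<^sup>+t. ennreal \<bar>F (c * t)\<bar> \<partial>height_measure k 0)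
        \<le> lorentz_norm p (weighted_sphere e a1 a2) (\<lambda>x. F \<bar>x \<bullet> e\<bar>)"
    proof (rule nn_integral_le_lorentz_norm)
      show "sigma_finite_measure (height_measure k 0)"
        using finite_height_measure[of k 0] k by (simp add: finite_measure.axioms(1))
      fix s :: real
      define E where "E = {u. \<bar>F u\<bar> > s}"
      have E: "E \<in> sets borel" unfolding E_def by measurable
      have "ennreal (H * (K * (1 - c\<^sup>2) powr (g1 / 2) * c powr g2)) *
          emeasure (height_measure k 0) {t. c * t \<in> E}
          \<le> ennreal H * epowr (emeasure (height_measure (a1 + real n) a2) E) (1 / p)"
        using dilation[OF E, of c] c by (simp add: H_def ennreal_mult' mult.assoc mult_left_mono)
      also have "\<dots> = epowr (emeasure (weighted_sphere e a1 a2) {x. \<bar>x \<bullet> e\<bar> \<in> E}) (1 / p)"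
        using emeasure_weighted_sphere[OF E e n, of a1 a2] const by (simp add: H_def epowr_cmult)
      finally show "ennreal (H * (K * (1 - c\<^sup>2) powr (g1 / 2) * c powr g2)) *
          emeasure (height_measure k 0) {t \<in> space (height_measure k 0). s < \<bar>F (c * t)\<bar>}
        \<le> epowr (emeasure (weighted_sphere e a1 a2)
            {x \<in> space (weighted_sphere e a1 a2). s < \<bar>F \<bar>x \<bullet> e\<bar>\<bar>}) (1 / p)"
        by (simp add: E_def weighted_sphere_def)
    qed (use p in auto)
    then show ?thesis by (simp add: mult_ac)
  qed
  then show thesis
    using that[of "p * (H * K)"] p K const unfolding H_def p_def by simp
qed

lemma
  fixes V :: "(real^'m) set" and F :: "real \<Rightarrow> real"
  assumes F[measurable]: "F \<in> borel_measurable borel" and V: "subspace V" "dim V = CARD('k::finite)"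
    and e: "norm e = 1" and k: "CARD('k) = k + 1" "1 \<le> k"
    and b: "b > 0" and r: "r \<ge> 0"
    and bound: "ennreal b * (\<integral>\<^sup>+t. ennreal \<bar>F (cos (dist_origin e V) * t)\<bar> \<partial>height_measure (real k) 0)
        \<le> ennreal r"
  shows radon_integrable_if_nn_integral_le: "radon_integrable TYPE('k) (\<lambda>x. F \<bar>x \<bullet> e\<bar>) V"
    and abs_radon_le: "b * \<bar>radon TYPE('k) (\<lambda>x. F \<bar>x \<bullet> e\<bar>) V\<bar> \<le> height_const k * r"
proof -
  let ?h = "height_measure (real k) 0"
  define G where "G t = F (cos (dist_origin e V) * t)" for t
  have [measurable]: "G \<in> borel_measurable ?h" unfolding G_def[abs_def] by measurable
  have "(\<integral>\<^sup>+t. ennreal \<bar>G t\<bar> \<partial>?h) \<noteq> top"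
  proof
    assume "(\<integral>\<^sup>+t. ennreal \<bar>G t\<bar> \<partial>?h) = top"
    then show False using bound b by (simp add: G_def ennreal_mult_top top_unique)
  qed
  then have G: "integrable ?h G"
    by (intro integrableI_bounded) (auto simp: less_top)
  then show "radon_integrable TYPE('k) (\<lambda>x. F \<bar>x \<bullet> e\<bar>) V"
    using radon_integrable_height_iff[OF F V e k] by (simp add: G_def[abs_def])
  have "ennreal b * ennreal (\<integral>t. \<bar>G t\<bar> \<partial>?h) \<le> ennreal r"
    using bound nn_integral_eq_integral[OF integrable_abs[OF G]] by (simp add: G_def)
  then have "b * (\<integral>t. \<bar>G t\<bar> \<partial>?h) \<le> r"
    using b r by (simp add: ennreal_mult'[symmetric])
  moreover have "b * \<bar>\<integral>t. G t \<partial>?h\<bar> \<le> b * (\<integral>t. \<bar>G t\<bar> \<partial>?h)"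
    using b by (intro mult_left_mono integral_abs_bound) auto
  ultimately have "height_const k * (b * \<bar>\<integral>t. G t \<partial>?h\<bar>) \<le> height_const k * r"
    using height_const_pos[of k] k by (intro mult_left_mono) auto
  then show "b * \<bar>radon TYPE('k) (\<lambda>x. F \<bar>x \<bullet> e\<bar>) V\<bar> \<le> height_const k * r"
    using radon_height[OF F V e k] height_const_pos[of k] k by (simp add: G_def abs_mult mult_ac)
qed

lemma abs_weighted_radon_le:
  fixes V :: "(real^'m) set" and F :: "real \<Rightarrow> real"
  assumes F: "F \<in> borel_measurable borel" and V: "Xi e k V" "e \<notin> V" and e: "norm e = 1"
    and k: "CARD('k::finite) = k + 1" "1 \<le> k" and B: "B > 0" and r: "r \<ge> 0"
    and bound: "\<And>c. \<lbrakk>0 < c; c < 1\<rbrakk> \<Longrightarrow> ennreal (B * ((1 - c\<^sup>2) powr (g1 / 2) * c powr g2)) *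
      (\<integral>\<^sup>+t. ennreal \<bar>F (c * t)\<bar> \<partial>height_measure (real k) 0) \<le> ennreal r"
  shows "radon_integrable TYPE('k) (\<lambda>x. F \<bar>x \<bullet> e\<bar>) V \<and>
    \<bar>sin (dist_origin e V) powr g1 * cos (dist_origin e V) powr g2 * radon TYPE('k) (\<lambda>x. F \<bar>x \<bullet> e\<bar>) V\<bar>
      \<le> height_const k / B * r"
proof -
  define c where "c = cos (dist_origin e V)"
  define b where "b = (1 - c\<^sup>2) powr (g1 / 2) * c powr g2"
  have c: "0 < c" "c < 1"
    unfolding c_def using Xi_imp_cos_dist_origin_pos[OF V(1) e] cos_dist_origin_less_1[OF V(1) e V(2)]
    by auto
  then have b: "b > 0" using one_minus_square_pos[OF c] by (simp add: b_def)
  have weight: "sin (dist_origin e V) powr g1 * cos (dist_origin e V) powr g2 = b"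
    unfolding b_def c_def using sin_dist_origin_powr[of V e g1] Xi_imp_nontrivial[OF V(1)] e by simp
  have plane: "subspace V" "dim V = CARD('k)" using V(1) k by (auto simp: Xi_def)
  have "b * \<bar>radon TYPE('k) (\<lambda>x. F \<bar>x \<bullet> e\<bar>) V\<bar> \<le> height_const k / B * r"
    using abs_radon_le[OF F plane e k _ r bound[OF c, folded b_def, unfolded c_def]] B b
    by (simp add: field_simps)
  then show ?thesis
    unfolding weight
    using radon_integrable_if_nn_integral_le[OF F plane e k _ r bound[OF c, folded b_def, unfolded c_def]] B b
    by (simp add: abs_mult)
qed

lemma radon_Linf_estimate_if_dilation_estimate:
  fixes i0 :: "'m::finite"
  assumes m: "CARD('m) = n + 1" and k: "CARD('k::finite) = k + 1" "1 \<le> k" "k < n" and a2: "a2 > 0"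
    and estimate: "dilation_estimate (sets borel) (real k) (a1 + real n) (1 + a2) g1 g2"
  shows "radon_Linf_estimate TYPE('k) (axis i0 1 :: real^'m) a1 a2 g1 g2"
proof -
  define e where "e = (axis i0 1 :: real^'m)"
  define W where "W = weighted_sphere e a1 a2"
  have e: "norm e = 1" by (simp add: e_def)
  obtain B where B: "B > 0" and bound: "\<And>F c. \<lbrakk>F \<in> borel_measurable borel; 0 < c; c < 1\<rbrakk> \<Longrightarrow>
      ennreal (B * ((1 - c\<^sup>2) powr (g1 / 2) * c powr g2)) *
          (\<integral>\<^sup>+t. ennreal \<bar>F (c * t)\<bar> \<partial>height_measure (real k) 0)
        \<le> lorentz_norm (1 + a2) W (\<lambda>x. F \<bar>x \<bullet> e\<bar>)"
    unfolding W_def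
    using dilation_estimate_imp_nn_integral_le_lorentz_norm[OF estimate _ a2, of e] m k by (auto simp: e_def)
  show ?thesis
    unfolding radon_Linf_estimate_def Let_def e_def[symmetric] W_def[symmetric]
  proof (intro exI allI impI)
    fix F :: "real \<Rightarrow> real"
    assume F: "F \<in> borel_measurable borel" and "lorentz_norm (1 + a2) W (\<lambda>x. F \<bar>x \<bullet> e\<bar>) < \<infinity>"
    then have bound_F: "ennreal (B * ((1 - c\<^sup>2) powr (g1 / 2) * c powr g2)) *
        (\<integral>\<^sup>+t. ennreal \<bar>F (c * t)\<bar> \<partial>height_measure (real k) 0)
        \<le> ennreal (enn2real (lorentz_norm (1 + a2) W (\<lambda>x. F \<bar>x \<bullet> e\<bar>)))" if "0 < c" "c < 1" for c
      using bound[OF F that] by (simp add: less_top)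
    have "AE w in (lborel :: (real^'m^'k) measure). e \<notin> row_span w"
      using m k e by (intro AE_not_in_row_span) auto
    then show "AE w in (lborel :: (real^'m^'k) measure). Xi e (CARD('k) - 1) (row_span w) \<longrightarrow>
        radon_integrable TYPE('k) (\<lambda>x. F \<bar>x \<bullet> e\<bar>) (row_span w) \<and>
        \<bar>sin (dist_origin e (row_span w)) powr g1 * cos (dist_origin e (row_span w)) powr g2 *
          radon TYPE('k) (\<lambda>x. F \<bar>x \<bullet> e\<bar>) (row_span w)\<bar>
          \<le> height_const k / B * enn2real (lorentz_norm (1 + a2) W (\<lambda>x. F \<bar>x \<bullet> e\<bar>))"
    proof (eventually_elim, intro impI)
      fix w :: "real^'m^'k"
      assume "e \<notin> row_span w" "Xi e (CARD('k) - 1) (row_span w)"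
      then show "radon_integrable TYPE('k) (\<lambda>x. F \<bar>x \<bullet> e\<bar>) (row_span w) \<and>
        \<bar>sin (dist_origin e (row_span w)) powr g1 * cos (dist_origin e (row_span w)) powr g2 *
          radon TYPE('k) (\<lambda>x. F \<bar>x \<bullet> e\<bar>) (row_span w)\<bar>
          \<le> height_const k / B * enn2real (lorentz_norm (1 + a2) W (\<lambda>x. F \<bar>x \<bullet> e\<bar>))"
        using k by (intro abs_weighted_radon_le[OF F _ _ e k(1,2) B _ bound_F]) auto
    qed
  qed
qed

subsection \<open>From the Radon transform to the dilation estimate\<close>

lemma abs_weighted_radon_indicator:
  fixes V :: "(real^'m) set"
  assumes E[measurable]: "E \<in> sets borel" and V: "Xi e k V"
    and e: "norm e = 1" and k: "CARD('k::finite) = k + 1" "1 \<le> k"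
  shows "\<bar>sin (dist_origin e V) powr g1 * cos (dist_origin e V) powr g2 *
      radon TYPE('k) (\<lambda>x. indicator E \<bar>x \<bullet> e\<bar>) V\<bar> =
    height_const k * ((1 - (cos (dist_origin e V))\<^sup>2) powr (g1 / 2) * cos (dist_origin e V) powr g2 *
      measure (height_measure (real k) 0) {t. cos (dist_origin e V) * t \<in> E})"
proof -
  have "subspace V" "dim V = CARD('k)" using V k by (auto simp: Xi_def)
  moreover have "(\<lambda>t. indicator E (cos (dist_origin e V) * t) :: real)
      = indicator {t. cos (dist_origin e V) * t \<in> E}"
    by (auto simp: indicator_def)
  ultimately have "radon TYPE('k) (\<lambda>x. indicator E \<bar>x \<bullet> e\<bar>) V =
      height_const k * measure (height_measure (real k) 0) {t. cos (dist_origin e V) * t \<in> E}"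
    using radon_height[OF _ _ _ e k, of "indicator E" V] by simp
  then show ?thesis
    using sin_dist_origin_powr[of V e g1] Xi_imp_nontrivial[OF V] e height_const_pos[of k] k
    by (simp add: abs_mult)
qed

lemma emeasure_dilation_le_if_weighted_radon_le:
  fixes V :: "(real^'m) set"
  assumes E: "E \<in> sets borel" and V: "Xi e k V" and e: "norm e = 1"
    and k: "CARD('k::finite) = k + 1" "1 \<le> k" and L: "L > 0"
    and bound: "\<bar>sin (dist_origin e V) powr g1 * cos (dist_origin e V) powr g2 *
      radon TYPE('k) (\<lambda>x. indicator E \<bar>x \<bullet> e\<bar>) V\<bar> \<le> L * r"
  defines "c \<equiv> cos (dist_origin e V)"
  shows "ennreal (height_const k / L * (1 - c\<^sup>2) powr (g1 / 2) * c powr g2) *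
    emeasure (height_measure (real k) 0) {t. c * t \<in> E} \<le> ennreal r"
proof -
  interpret finite_measure "height_measure (real k) 0" using k by (intro finite_height_measure) auto
  define b where "b = (1 - c\<^sup>2) powr (g1 / 2) * c powr g2"
  define \<mu> where "\<mu> = measure (height_measure (real k) 0) {t. c * t \<in> E}"
  have "height_const k * (b * \<mu>) \<le> L * r"
    using bound unfolding abs_weighted_radon_indicator[OF E V e k] b_def \<mu>_def c_def .
  then have "height_const k / L * b * \<mu> \<le> r" using L by (simp add: field_simps)
  moreover have "height_const k > 0" using k by (intro height_const_pos) simp
  ultimately show ?thesis
    using L by (simp add: emeasure_eq_measure \<mu>_def b_def ennreal_mult''[symmetric] mult.assoc ennreal_leI)
qed

lemma radon_Linf_estimate_indicatorE:
  fixes e :: "real^'m"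
  assumes "radon_Linf_estimate TYPE('k::finite) e a1 a2 g1 g2"
  obtains C where
    "\<And>E. \<lbrakk>E \<in> sets borel; lorentz_norm (1 + a2) (weighted_sphere e a1 a2) (\<lambda>x. indicator E \<bar>x \<bullet> e\<bar>) < \<infinity>\<rbrakk> \<Longrightarrow>
      AE w in (lborel :: (real^'m^'k) measure). Xi e (CARD('k) - 1) (row_span w) \<longrightarrow>
        \<bar>sin (dist_origin e (row_span w)) powr g1 * cos (dist_origin e (row_span w)) powr g2 *
          radon TYPE('k) (\<lambda>x. indicator E \<bar>x \<bullet> e\<bar>) (row_span w)\<bar>
          \<le> C * enn2real (lorentz_norm (1 + a2) (weighted_sphere e a1 a2) (\<lambda>x. indicator E \<bar>x \<bullet> e\<bar>))"
proof -
  have AE_mono: "AE w in M. P w \<longrightarrow> R w" if "AE w in M. P w \<longrightarrow> Q w \<and> R w"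
    for M :: "(real^'m^'k) measure" and P Q R
    using that by (rule eventually_mono) blast
  show thesis
    using assms unfolding radon_Linf_estimate_def Let_def
  proof (elim exE, goal_cases)
    case (1 C)
    show thesis
      by (rule that, rule AE_mono, rule 1[rule_format, OF borel_measurable_indicator])
  qed
qed

lemma lorentz_norm_height_indicator:
  fixes e :: "'a::euclidean_space"
  assumes E[measurable]: "E \<in> sets borel" and e: "e \<in> Basis" and n: "DIM('a) = n + 1" "n \<ge> 1" and p: "p > 0"
  shows "lorentz_norm p (weighted_sphere e a1 a2) (\<lambda>x. indicator E \<bar>x \<bullet> e\<bar>) =
    ennreal (p * height_const n powr (1 / p)) * epowr (emeasure (height_measure (a1 + real n) a2) E) (1 / p)"
proof -
  have indicator: "(\<lambda>x. indicator E \<bar>x \<bullet> e\<bar> :: real) = indicator {x. \<bar>x \<bullet> e\<bar> \<in> E}"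
    by (auto simp: indicator_def)
  have "{x. \<bar>x \<bullet> e\<bar> \<in> E} \<in> sets borel" by measurable
  then have "{x. \<bar>x \<bullet> e\<bar> \<in> E} \<in> sets (weighted_sphere e a1 a2)" by (simp add: weighted_sphere_def)
  then show ?thesis
    unfolding indicator using p n height_const_pos[of n] emeasure_weighted_sphere[OF E e n, of a1 a2]
    by (simp add: lorentz_norm_indicator epowr_cmult ennreal_mult' mult.assoc)
qed

lemma radon_Linf_estimate_imp_AE_dilation_estimate:
  fixes i0 :: "'m::finite"
  defines "e \<equiv> axis i0 1 :: real^'m"
  defines "c \<equiv> \<lambda>w :: real^'m^'k. cos (dist_origin e (row_span w))"
  assumes m: "CARD('m) = n + 1" and k: "CARD('k::finite) = k + 1" "1 \<le> k" "k < n" and a2: "a2 > 0"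
    and estimate: "radon_Linf_estimate TYPE('k) e a1 a2 g1 g2"
  obtains K :: real where "K > 0"
    "\<And>E. E \<in> sets borel \<Longrightarrow> AE w in lborel. Xi e k (row_span w) \<longrightarrow>
      ennreal (K * (1 - (c w)\<^sup>2) powr (g1 / 2) * c w powr g2) *
          emeasure (height_measure (real k) 0) {t. c w * t \<in> E}
        \<le> epowr (emeasure (height_measure (a1 + real n) a2) E) (1 / (1 + a2))"
proof -
  define p where "p = 1 + a2"
  define norm_E where "norm_E E = lorentz_norm p (weighted_sphere e a1 a2) (\<lambda>x. indicator E \<bar>x \<bullet> e\<bar>)" for E
  define R where "R E w = \<bar>sin (dist_origin e (row_span w)) powr g1 * c w powr g2 *
      radon TYPE('k) (\<lambda>x. indicator E \<bar>x \<bullet> e\<bar>) (row_span w)\<bar>" for E w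
  have e: "norm e = 1" and p: "p > 0" using a2 by (auto simp: e_def p_def)
  obtain C where C: "\<And>E. \<lbrakk>E \<in> sets borel; norm_E E < \<infinity>\<rbrakk> \<Longrightarrow>
      AE w in (lborel :: (real^'m^'k) measure). Xi e k (row_span w) \<longrightarrow> R E w \<le> C * enn2real (norm_E E)"
    using radon_Linf_estimate_indicatorE[OF estimate] k unfolding norm_E_def R_def p_def c_def by auto
  define L where "L = (\<bar>C\<bar> + 1) * (p * height_const n powr (1 / p))"
  have const: "height_const n > 0" "height_const k > 0" using k by (auto intro: height_const_pos)
  have L: "L > 0" using p const by (auto simp: L_def intro!: mult_pos_pos)
  have "AE w in lborel. Xi e k (row_span w) \<longrightarrow>
      ennreal (height_const k / L * (1 - (c w)\<^sup>2) powr (g1 / 2) * c w powr g2) *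
        emeasure (height_measure (real k) 0) {t. c w * t \<in> E}
      \<le> epowr (emeasure (height_measure (a1 + real n) a2) E) (1 / p)" if E: "E \<in> sets borel" for E
  proof (cases "emeasure (height_measure (a1 + real n) a2) E")
    case (real y)
    have norm_E: "norm_E E = ennreal (p * height_const n powr (1 / p) * y powr (1 / p))"
      using lorentz_norm_height_indicator[OF E _ _ _ p, of e n a1 a2] m k real p
      by (simp add: norm_E_def e_def epowr_ennreal ennreal_mult')
    have "C * enn2real (norm_E E) \<le> L * y powr (1 / p)"
      using p by (auto simp: norm_E L_def mult.assoc intro!: mult_right_mono)
    moreover have "norm_E E < \<infinity>" by (simp add: norm_E)
    ultimately have "AE w in (lborel :: (real^'m^'k) measure). Xi e k (row_span w) \<longrightarrow> R E w \<le> L * y powr (1 / p)"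
      using C[OF E] by (auto elim!: eventually_mono)
    then show ?thesis
      unfolding R_def c_def real(2) epowr_ennreal[OF real(1)]
      by (rule eventually_mono) (blast intro: emeasure_dilation_le_if_weighted_radon_le[OF E _ e k(1,2) L])
  qed (simp add: epowr_def)
  then show thesis using that[of "height_const k / L"] L const unfolding p_def by simp
qed

lemma emeasure_dilation_le_liminf:
  fixes c :: real and M :: "real measure"
  assumes M[measurable_cong]: "sets M = sets borel" and E: "open E" and lim: "s \<longlonglongrightarrow> c"
  shows "emeasure M {t. c * t \<in> E} \<le> liminf (\<lambda>n. emeasure M {t. s n * t \<in> E})"
proof -
  have [measurable]: "E \<in> sets borel" using E by simp
  have dilation: "{t. x * t \<in> E} \<in> sets M" for x :: real
  proof -
    have "{t. x * t \<in> E} \<in> sets borel" by measurable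
    then show ?thesis using M by simp
  qed
  have "indicator {t. c * t \<in> E} t \<le> liminf (\<lambda>n. indicator {t. s n * t \<in> E} t :: ennreal)" for t
  proof (cases "c * t \<in> E")
    case True
    have "(\<lambda>n. s n * t) \<longlonglongrightarrow> c * t" using lim by (intro tendsto_intros)
    then have "\<forall>\<^sub>F n in sequentially. s n * t \<in> E" using E True by (rule topological_tendstoD)
    then show ?thesis by (intro Liminf_bounded) (auto elim!: eventually_mono)
  qed simp
  then have "(\<integral>\<^sup>+t. indicator {t. c * t \<in> E} t \<partial>M) \<le> (\<integral>\<^sup>+t. liminf (\<lambda>n. indicator {t. s n * t \<in> E} t) \<partial>M)"
    by (intro nn_integral_mono)
  also have "\<dots> \<le> liminf (\<lambda>n. \<integral>\<^sup>+t. indicator {t. s n * t \<in> E} t \<partial>M)"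
    using dilation by (intro nn_integral_liminf) simp
  finally show ?thesis using dilation by simp
qed

lemma lower_semicontinuous_le_if_dense:
  fixes w :: "real \<Rightarrow> real" and \<mu> :: "real \<Rightarrow> ennreal"
  assumes w: "isCont w c" "w c > 0" and d: "c < d"
    and lsc: "\<And>s. s \<longlonglongrightarrow> c \<Longrightarrow> \<mu> c \<le> liminf (\<lambda>n. \<mu> (s n))"
    and dense: "\<And>\<beta>. \<lbrakk>c < \<beta>; \<beta> < d\<rbrakk> \<Longrightarrow> \<exists>x. c < x \<and> x < \<beta> \<and> ennreal (w x) * \<mu> x \<le> R"
  shows "ennreal (w c) * \<mu> c \<le> R"
proof (cases R)
  case (real r)
  define \<beta> where "\<beta> n = c + (d - c) / real (n + 2)" for n
  have "(d - c) / real (n + 2) < (d - c) / 1" for n using d by (intro divide_strict_left_mono) auto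
  then have "c < \<beta> n \<and> \<beta> n < d" for n using d by (simp add: \<beta>_def less_diff_eq add.commute)
  then have "\<exists>x. c < x \<and> x < \<beta> n \<and> ennreal (w x) * \<mu> x \<le> ennreal r" for n
    unfolding real(2)[symmetric] by (intro dense) auto
  then obtain s where s: "\<And>n. c < s n" "\<And>n. s n < \<beta> n" "\<And>n. ennreal (w (s n)) * \<mu> (s n) \<le> ennreal r"
    by metis
  have "s \<longlonglongrightarrow> c"
  proof (rule tendsto_sandwich[of "\<lambda>_. c" s _ \<beta>])
    have "(\<lambda>n. c + (d - c) * inverse (real (n + 2))) \<longlonglongrightarrow> c + (d - c) * 0"
      by (intro tendsto_intros LIMSEQ_ignore_initial_segment[OF lim_inverse_n])
    then show "\<beta> \<longlonglongrightarrow> c" by (simp add: \<beta>_def[abs_def] divide_inverse)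
  qed (use s in \<open>auto intro!: always_eventually less_imp_le\<close>)
  then have w_lim: "(\<lambda>n. w (s n)) \<longlonglongrightarrow> w c" using w(1) by (rule isCont_tendsto_compose[rotated])
  have "\<mu> c \<le> liminf (\<lambda>n. \<mu> (s n))" using \<open>s \<longlonglongrightarrow> c\<close> by (rule lsc)
  also have "\<dots> \<le> liminf (\<lambda>n. ennreal (r / w (s n)))"
  proof (rule Liminf_mono)
    show "\<forall>\<^sub>F n in sequentially. \<mu> (s n) \<le> ennreal (r / w (s n))"
      using order_tendstoD(1)[OF w_lim w(2)]
    proof eventually_elim
      fix n assume "0 < w (s n)"
      then show "\<mu> (s n) \<le> ennreal (r / w (s n))"
        using mult_left_mono[OF s(3)[of n], of "ennreal (1 / w (s n))"]
        by (simp add: mult.assoc[symmetric] ennreal_mult'[symmetric])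
    qed
  qed
  also have "\<dots> = ennreal (r / w c)"
    using w(2) by (intro lim_imp_Liminf tendsto_ennrealI tendsto_intros w_lim) auto
  finally have "ennreal (w c) * \<mu> c \<le> ennreal (w c) * ennreal (r / w c)" by (rule mult_left_mono) simp
  then show ?thesis using w(2) real by (simp add: ennreal_mult'[symmetric])
qed simp

lemma dilation_estimate_open_if_dense:
  assumes K: "K > 0"
    and dense: "\<And>E \<alpha> \<beta>. \<lbrakk>open E; 0 < \<alpha>; \<alpha> < \<beta>; \<beta> < 1\<rbrakk> \<Longrightarrow> \<exists>c. \<alpha> < c \<and> c < \<beta> \<and>
      ennreal (K * (1 - c\<^sup>2) powr (\<gamma> / 2) * c powr \<delta>) * emeasure (height_measure k 0) {t. c * t \<in> E}
        \<le> epowr (emeasure (height_measure A (p - 1)) E) (1 / p)"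
  shows "dilation_estimate (Collect open) k A p \<gamma> \<delta>"
  unfolding dilation_estimate_def
proof (intro exI[of _ K] conjI ballI K)
  fix E :: "real set" and c :: real
  assume "E \<in> Collect open" and "c \<in> {0<..<1}"
  then have E: "open E" and c: "0 < c" "c < 1" by auto
  show "ennreal (K * (1 - c\<^sup>2) powr (\<gamma> / 2) * c powr \<delta>) * emeasure (height_measure k 0) {t. c * t \<in> E}
    \<le> epowr (emeasure (height_measure A (p - 1)) E) (1 / p)"
  proof (rule lower_semicontinuous_le_if_dense[OF _ _ c(2)])
    show "isCont (\<lambda>c. K * (1 - c\<^sup>2) powr (\<gamma> / 2) * c powr \<delta>) c"
      using c one_minus_square_pos[OF c] by (intro continuous_intros) auto
    show "0 < K * (1 - c\<^sup>2) powr (\<gamma> / 2) * c powr \<delta>"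
      using K c one_minus_square_pos[OF c] by simp
    show "emeasure (height_measure k 0) {t. c * t \<in> E}
        \<le> liminf (\<lambda>n. emeasure (height_measure k 0) {t. s n * t \<in> E})"
      if "s \<longlonglongrightarrow> c" for s
      using that E by (intro emeasure_dilation_le_liminf) auto
  qed (use dense[OF E c(1)] in blast)
qed

lemma dilation_estimate_open_if_radon_Linf_estimate:
  fixes i0 :: "'m::finite"
  assumes m: "CARD('m) = n + 1" and k: "CARD('k::finite) = k + 1" "1 \<le> k" "k < n" and a2: "a2 > 0"
    and estimate: "radon_Linf_estimate TYPE('k) (axis i0 1 :: real^'m) a1 a2 g1 g2"
  shows "dilation_estimate (Collect open) (real k) (a1 + real n) (1 + a2) g1 g2"
proof -
  define e where "e = (axis i0 1 :: real^'m)"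
  define c where "c w = cos (dist_origin e (row_span w))" for w :: "real^'m^'k"
  obtain K where K: "K > 0" and AE: "\<And>E. E \<in> sets borel \<Longrightarrow> AE w in lborel. Xi e k (row_span w) \<longrightarrow>
      ennreal (K * (1 - (c w)\<^sup>2) powr (g1 / 2) * c w powr g2) *
          emeasure (height_measure (real k) 0) {t. c w * t \<in> E}
        \<le> epowr (emeasure (height_measure (a1 + real n) a2) E) (1 / (1 + a2))"
    using radon_Linf_estimate_imp_AE_dilation_estimate[OF m k a2 estimate] unfolding e_def c_def by blast
  show ?thesis
  proof (rule dilation_estimate_open_if_dense[OF K])
    fix E :: "real set" and \<alpha> \<beta> :: real
    assume E: "open E" and ab: "0 < \<alpha>" "\<alpha> < \<beta>" "\<beta> < 1"
    have "CARD('k) < CARD('m)" using m k by simp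
    then obtain U :: "(real^'m^'k) set" where U: "open U" "U \<noteq> {}"
      "\<And>w. w \<in> U \<Longrightarrow> Xi e k (row_span w) \<and> \<alpha> < c w \<and> c w < \<beta>"
      using ex_open_Xi_height_between[OF _ k(1) ab, of i0] unfolding e_def c_def by metis
    obtain w where "w \<in> U" "Xi e k (row_span w) \<longrightarrow>
      ennreal (K * (1 - (c w)\<^sup>2) powr (g1 / 2) * c w powr g2) *
          emeasure (height_measure (real k) 0) {t. c w * t \<in> E}
        \<le> epowr (emeasure (height_measure (a1 + real n) a2) E) (1 / (1 + a2))"
      using AE_lborel_imp_ex_in_open[OF AE[OF borel_open[OF E]] U(1,2)] by blast
    then show "\<exists>c. \<alpha> < c \<and> c < \<beta> \<and>
      ennreal (K * (1 - c\<^sup>2) powr (g1 / 2) * c powr g2) *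
          emeasure (height_measure (real k) 0) {t. c * t \<in> E}
        \<le> epowr (emeasure (height_measure (a1 + real n) (1 + a2 - 1)) E) (1 / (1 + a2))"
      using U(3)[of w] by auto
  qed
qed

theorem theorem5p11:
  fixes n k :: nat and a1 a2 g1 g2 :: real and i0 :: "'m::finite"
  assumes "CARD('m) = n + 1" and "CARD('k::finite) = k + 1"
    and "n \<ge> 2" and "1 \<le> k" and "k \<le> n - 1" and "a2 > 0"
  shows "radon_Linf_estimate TYPE('k) (axis i0 1 :: real^'m) a1 a2 g1 g2 \<longleftrightarrow>
     (g1 \<ge> max 0 ((a1 + real n) / (1 + a2) - real k) \<and> g2 \<ge> 1 \<and>
      (k = 1 \<longrightarrow> 1 + a2 \<ge> 2))"
    (is "?estimate \<longleftrightarrow> ?exponents")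
proof -
  have "k < n" using assms by linarith
  note reduction = assms(1,2,4) this assms(6)
  have dimension: "real k * (1 + a2) \<ge> 2 \<longleftrightarrow> (k = 1 \<longrightarrow> 1 + a2 \<ge> 2)"
    using assms mult_mono[of 2 "real k" 1 "1 + a2"] by (cases "k = 1") auto
  show ?thesis
  proof
    assume ?estimate
    then have "dilation_estimate (Collect open) (real k) (a1 + real n) (1 + a2) g1 g2"
      by (rule dilation_estimate_open_if_radon_Linf_estimate[OF reduction])
    from dilation_estimate_necessary[OF this] show ?exponents
      using assms dimension by auto
  next
    assume ?exponents
    then show ?estimate
      using assms dimension
      by (intro radon_Linf_estimate_if_dilation_estimate[OF reduction] dilation_estimate_sufficient) auto
  qed
qed

end
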